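(* Let $n$ be a positive integer that is not of the form $\frac{k(k+1)}{2}+1$ for any integer $k\ge 0$. Then $C_3(n)=\frac{1}{3}D_3(n)$.
   Context: $C_3(n)$ is the number of partitions of $n$ in which the largest part is divisible by $3$, say equal to $3j$, and every part less than or equal to $j$ appears fewer than $3$ times. $D_3(n)$ is the number of partitions of $n$ into non-negative parts (i.e. $0$ is allowed as a part) in which the smallest part occurs exactly $3$ times and every other part occurs fewer than $3$ times. *)

theory Defs
  imports Complex_Main "HOL-Library.Multiset"
begin

text \<open>
  Partitions are represented as finite multisets of natural numbers, so that
  \<open>count P p\<close> is the number of times the part \<open>p\<close> appears.
\<close>

definition partitions_nonneg :: "nat \<Rightarrow> nat multiset set" where
  "partitions_nonneg n = {P. sum_mset P = n}"

definition partitions :: "nat \<Rightarrow> nat multiset set" where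
  "partitions n = {P \<in> partitions_nonneg n. 0 \<notin># P}"

definition C3 :: "nat \<Rightarrow> nat" where
  "C3 n = card {P \<in> partitions n. P \<noteq> {#} \<and>
     (\<exists>j. Max_mset P = 3 * j \<and> (\<forall>p \<in># P. p \<le> j \<longrightarrow> count P p < 3))}"

text \<open>
  The set counted below is finite although \<open>partitions_nonneg n\<close> is not:
  the part \<open>0\<close>, if present, is the smallest part and hence occurs exactly three times.
\<close>

definition D3 :: "nat \<Rightarrow> nat" where
  "D3 n = card {P \<in> partitions_nonneg n. P \<noteq> {#} \<and>
     count P (Min_mset P) = 3 \<and> (\<forall>p \<in># P. p \<noteq> Min_mset P \<longrightarrow> count P p < 3)}"

end

theory Submission
  imports Defs "HOL-Complex_Analysis.Cauchy_Integral_Formula"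
begin

text \<open>
  Write \<open>(a; q)\<close> for the infinite product \<open>(1 - a)(1 - a q)(1 - a q^2)\<dots>\<close> and let
  \<open>h(q, x) = \<Sum>n. q^n (x q^(n+1); q) (q^(n+1) / x; q)\<close>. Telescoping yields a functional equation
  linking \<open>h(q, x)\<close> with \<open>h(q, x q)\<close>; iterating it gives the partial theta identity
  \<open>h(q, x) = \<Sum>n. (x^(4n+1) q^(tri (2n)) - x^(4n+3) q^(tri (2n+1)))
     + (x; q) (q/x; q) \<Sum>n. (-1)^n x^(3n) q^(n(3n+1)/2) (1 - x^2 q^(2n+1))\<close>,
  where \<open>tri k = k(k+1)/2\<close>. For a primitive cube root of unity \<open>w\<close> the generating function of
  \<open>D3\<close> is \<open>1 + q h(q, w)\<close>, and that of \<open>C3\<close> is \<open>P (q - q^2 h(q^3, q)) - q\<close> with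
  \<open>P = (w q; q) (w^2 q; q) = 1 / ((q; q^3) (q^2; q^3))\<close>. Since \<open>h(q, w) = h(q, w^2)\<close>, a suitable
  combination of the identity at \<open>w\<close> and at \<open>w^2\<close> removes half of the pentagonal terms from
  \<open>h(q, w)\<close>. What remains is \<open>3 P A\<close>, \<open>A = \<Sum>n. (-1)^n q^(n(3n+1)/2)\<close>, plus powers
  \<open>q^(tri k)\<close>. The partial theta series in \<open>h(q^3, q)\<close> turns out to be
  \<open>(1 - A) / q\<close>, so the generating function of \<open>C3\<close> is \<open>q P A\<close> plus powers \<open>q^(tri k + 1)\<close>. Hence all
  coefficients of the generating function of \<open>3 C3 - D3\<close> at positive exponents not of the
  form \<open>tri k + 1\<close> vanish.
\<close>

section \<open>Infinite products\<close>

definition qpoch :: "complex \<Rightarrow> complex \<Rightarrow> complex" where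
  "qpoch q a = (\<Prod>k. 1 - a * q ^ k)"

lemma qpoch_LIMSEQ:
  assumes "norm q < 1"
  shows "(\<lambda>N. \<Prod>k<N. 1 - a * q ^ k) \<longlonglongrightarrow> qpoch q a"
proof -
  have "summable (\<lambda>k. norm a * norm q ^ k)"
    using assms by (intro summable_mult summable_geometric) auto
  hence "summable (\<lambda>k. norm ((1 - a * q ^ k) - 1))"
    by (simp add: norm_mult norm_power)
  hence "convergent_prod (\<lambda>k. 1 - a * q ^ k)"
    by (intro abs_convergent_prod_imp_convergent_prod) (simp add: abs_convergent_prod_conv_summable)
  thus ?thesis
    unfolding qpoch_def using convergent_prod_has_prod has_prod_imp_tendsto' by blast
qed

lemma qpoch_split:
  assumes "norm q < 1"
  shows "qpoch q a = (\<Prod>k<N. 1 - a * q ^ k) * qpoch q (a * q ^ N)"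
proof -
  have "(\<lambda>M. \<Prod>k<M + N. 1 - a * q ^ k) \<longlonglongrightarrow> qpoch q a"
    using qpoch_LIMSEQ[OF assms] by (rule LIMSEQ_ignore_initial_segment)
  moreover have "(\<Prod>k<M + N. 1 - a * q ^ k) =
      (\<Prod>k<N. 1 - a * q ^ k) * (\<Prod>k<M. 1 - (a * q ^ N) * q ^ k)" for M
    by (induction M) (simp_all add: power_add mult_ac)
  moreover have "(\<lambda>M. (\<Prod>k<N. 1 - a * q ^ k) * (\<Prod>k<M. 1 - (a * q ^ N) * q ^ k))
      \<longlonglongrightarrow> (\<Prod>k<N. 1 - a * q ^ k) * qpoch q (a * q ^ N)"
    by (intro tendsto_mult_left qpoch_LIMSEQ assms)
  ultimately show ?thesis
    using LIMSEQ_unique by auto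
qed

lemma qpoch_rec:
  assumes "norm q < 1"
  shows "qpoch q a = (1 - a) * qpoch q (a * q)"
  using qpoch_split[OF assms, of a 1] by simp

text \<open>Expanding the partial products, their distance from 1 is at most that of the product of
  1 + |a| |q|^k, and 1 + t <= exp t turns this into a geometric series in the exponent. The one
  estimate yields both uniform bounds and the limit 1 of late tails.\<close>

lemma norm_qpoch_minus_1_le:
  assumes "norm q < 1"
  shows "norm (qpoch q a - 1) \<le> exp (norm a / (1 - norm q)) - 1"
proof (rule tendsto_upperbound)
  show "(\<lambda>N. norm ((\<Prod>k<N. 1 - a * q ^ k) - 1)) \<longlonglongrightarrow> norm (qpoch q a - 1)"
    by (intro tendsto_intros qpoch_LIMSEQ assms)
  show "eventually (\<lambda>N. norm ((\<Prod>k<N. 1 - a * q ^ k) - 1)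
      \<le> exp (norm a / (1 - norm q)) - 1) sequentially"
  proof (rule always_eventually, rule allI)
    fix N
    have "norm ((\<Prod>k<N. 1 - a * q ^ k) - 1) \<le> (\<Prod>k<N. 1 + norm a * norm q ^ k) - 1"
      using norm_prod_minus1_le_prod_minus1[of "\<lambda>k. - a * q ^ k" "{..<N}"]
      by (simp add: norm_mult norm_power)
    also have "(\<Prod>k<N. 1 + norm a * norm q ^ k) \<le> (\<Prod>k<N. exp (norm a * norm q ^ k))"
      by (intro prod_mono) (auto intro: add_nonneg_nonneg)
    also have "\<dots> = exp (norm a * (\<Sum>k<N. norm q ^ k))"
      by (simp add: exp_sum sum_distrib_left)
    also have "\<dots> \<le> exp (norm a / (1 - norm q))"
    proof -
      have "(\<Sum>k<N. norm q ^ k) \<le> (\<Sum>k. norm q ^ k)"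
        using assms by (intro sum_le_suminf summable_geometric) auto
      also have "\<dots> = 1 / (1 - norm q)"
        using assms by (simp add: suminf_geometric)
      finally show ?thesis
        by (simp add: mult_left_mono divide_inverse)
    qed
    finally show "norm ((\<Prod>k<N. 1 - a * q ^ k) - 1) \<le> exp (norm a / (1 - norm q)) - 1"
      by simp
  qed
qed simp

lemma norm_qpoch_le:
  assumes "norm q < 1" "norm a \<le> R"
  shows "norm (qpoch q a) \<le> exp (R / (1 - norm q))"
proof -
  have "norm (qpoch q a) \<le> norm (qpoch q a - 1) + norm (1 :: complex)"
    by norm
  also have "\<dots> \<le> exp (norm a / (1 - norm q))"
    using norm_qpoch_minus_1_le[OF assms(1), of a] by simp
  also have "\<dots> \<le> exp (R / (1 - norm q))"
    using assms by (simp add: divide_right_mono)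
  finally show ?thesis .
qed

lemma qpoch_tendsto_1:
  assumes "norm q < 1"
  shows "(\<lambda>n. qpoch q (a * q ^ n)) \<longlonglongrightarrow> 1"
proof -
  have "(\<lambda>n. exp (norm (a * q ^ n) / (1 - norm q)) - 1) \<longlonglongrightarrow> exp (norm (a * 0) / (1 - norm q)) - 1"
    using assms by (intro tendsto_intros LIMSEQ_power_zero) auto
  hence "(\<lambda>n. exp (norm (a * q ^ n) / (1 - norm q)) - 1) \<longlonglongrightarrow> 0"
    by simp
  hence "(\<lambda>n. qpoch q (a * q ^ n) - 1) \<longlonglongrightarrow> 0"
    by (rule Lim_null_comparison[rotated]) (auto intro!: always_eventually norm_qpoch_minus_1_le assms)
  thus ?thesis
    by (simp add: LIM_zero_iff)
qed

section \<open>A partial theta identity\<close>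

text \<open>At a primitive cube root of unity \<open>x\<close>, paired factors multiply to 1 + q^k +
  q^(2k) with k > n. So this is then the generating function of partitions into parts exceeding
  \<open>n\<close>, each used at most twice.\<close>

definition qpoch_tail :: "complex \<Rightarrow> complex \<Rightarrow> nat \<Rightarrow> complex" where
  "qpoch_tail q x n = qpoch q (x * q ^ (n + 1)) * qpoch q (q ^ (n + 1) / x)"

definition qpoch_tail_sum :: "complex \<Rightarrow> complex \<Rightarrow> complex" where
  "qpoch_tail_sum q x = (\<Sum>n. q ^ n * qpoch_tail q x n)"

text \<open>Jacobi's theta product without the factor (q; q).\<close>

definition theta :: "complex \<Rightarrow> complex \<Rightarrow> complex" where
  "theta q x = qpoch q x * qpoch q (q / x)"

definition tri :: "nat \<Rightarrow> nat" where
  "tri k = k * (k + 1) div 2"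

lemma tri_0 [simp]: "tri 0 = 0"
  by (simp add: tri_def)

lemma tri_Suc [simp]: "tri (Suc k) = tri k + Suc k"
proof -
  have "Suc k * (Suc k + 1) = k * (k + 1) + 2 * Suc k" by simp
  thus ?thesis unfolding tri_def by simp
qed

lemma two_tri: "2 * tri k = k * (k + 1)"
  by (induction k) auto

context
  fixes q x :: complex
  assumes q: "norm q < 1" "q \<noteq> 0" and x: "x \<noteq> 0"
begin

lemma norm_qpoch_tail_le:
  "norm (qpoch_tail q x n) \<le> exp (norm x / (1 - norm q)) * exp (1 / norm x / (1 - norm q))"
proof -
  have le1: "norm q ^ (n + 1) \<le> 1"
    using q by (intro power_le_one) auto
  have "norm (x * q ^ (n + 1)) \<le> norm x"
    using mult_left_mono[OF le1, of "norm x"] by (simp add: norm_mult norm_power del: power_Suc)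
  moreover have "norm (q ^ (n + 1) / x) \<le> 1 / norm x"
    using divide_right_mono[OF le1, of "norm x"] by (simp add: norm_divide norm_power del: power_Suc)
  ultimately show ?thesis
    unfolding qpoch_tail_def norm_mult[of "qpoch _ _"] using q by (intro mult_mono norm_qpoch_le) simp_all
qed

lemma summable_qpoch_tail:
  assumes "norm c < 1"
  shows "summable (\<lambda>n. c ^ n * qpoch_tail q x n)"
proof (rule summable_comparison_test')
  show "summable (\<lambda>n. norm c ^ n * (exp (norm x / (1 - norm q)) * exp (1 / norm x / (1 - norm q))))"
    using assms by (intro summable_mult2 summable_geometric) auto
  show "norm (c ^ n * qpoch_tail q x n) \<le> norm c ^ n * (exp (norm x / (1 - norm q)) * exp (1 / norm x / (1 - norm q)))" for n
    unfolding norm_mult norm_power by (intro mult_left_mono norm_qpoch_tail_le) auto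
qed

lemma qpoch_tail_sum_sums: "(\<lambda>n. q ^ n * qpoch_tail q x n) sums qpoch_tail_sum q x"
  unfolding qpoch_tail_sum_def using summable_qpoch_tail q by (intro summable_sums) auto

lemma qpoch_tail_step:
  "qpoch q (x * q ^ n) * qpoch q (q ^ n / x) = (1 - x * q ^ n) * (1 - q ^ n / x) * qpoch_tail q x n"
  using qpoch_rec[OF q(1), of "x * q ^ n"] qpoch_rec[OF q(1), of "q ^ n / x"]
  by (simp add: qpoch_tail_def mult_ac)

text \<open>With T n = (x q^n; q) (q^n / x; q), the tail is T (n+1), and T n is (1 - x q^n) (1 - q^n
  / x) times it. Hence T (n+1) - T n equals ((x + 1/x) q^n - q^(2n)) times the tail, and the left
  side telescopes to 1 - T 0.\<close>

lemma qpoch_tail_square_sums: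
  "(\<lambda>n. (q\<^sup>2) ^ n * qpoch_tail q x n) sums
     (qpoch q x * qpoch q (1 / x) - 1 + (x + 1 / x) * qpoch_tail_sum q x)"
proof -
  define T where "T = (\<lambda>n. qpoch q (x * q ^ n) * qpoch q (q ^ n / x))"
  have "T \<longlonglongrightarrow> 1 * 1"
    unfolding T_def using qpoch_tendsto_1[OF q(1), of x] qpoch_tendsto_1[OF q(1), of "1 / x"]
    by (intro tendsto_mult) simp_all
  hence "(\<lambda>n. T (Suc n) - T n) sums (1 - T 0)"
    by (intro telescope_sums) simp
  hence "(\<lambda>n. (T (Suc n) - T n) - (x + 1 / x) * (q ^ n * qpoch_tail q x n)) sums
     ((1 - T 0) - (x + 1 / x) * qpoch_tail_sum q x)"
    by (rule sums_diff[OF _ sums_mult[OF qpoch_tail_sum_sums]])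
  hence "(\<lambda>n. - ((T (Suc n) - T n) - (x + 1 / x) * (q ^ n * qpoch_tail q x n))) sums
     (- ((1 - T 0) - (x + 1 / x) * qpoch_tail_sum q x))"
    by (rule sums_minus)
  moreover have "- ((T (Suc n) - T n) - (x + 1 / x) * (q ^ n * qpoch_tail q x n)) = (q\<^sup>2) ^ n * qpoch_tail q x n" for n
  proof -
    have "T (Suc n) = qpoch_tail q x n"
      by (simp add: T_def qpoch_tail_def)
    moreover have "T n = (1 - x * q ^ n) * (1 - q ^ n / x) * qpoch_tail q x n"
      unfolding T_def by (rule qpoch_tail_step)
    ultimately show ?thesis
      using x by (simp add: field_simps power_mult power2_eq_square power_mult_distrib)
  qed
  ultimately show ?thesis
    by (simp add: T_def algebra_simps)
qed

text \<open>Splitting 1 - x q^n off the first product reduces this to the series with weights q^n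
  and q^(2n). The half-shifted series is useful because it takes the same form at two different
  arguments, which produces the functional equation.\<close>

lemma shifted_qpoch_tail_sums:
  "(\<lambda>n. q ^ n * (qpoch q (x * q ^ n) * qpoch q (q ^ (n + 1) / x))) sums
     (x - x * (qpoch q x * qpoch q (1 / x)) - x\<^sup>2 * qpoch_tail_sum q x)"
proof -
  have "(\<lambda>n. q ^ n * qpoch_tail q x n - x * ((q\<^sup>2) ^ n * qpoch_tail q x n)) sums
     (qpoch_tail_sum q x - x * (qpoch q x * qpoch q (1 / x) - 1 + (x + 1 / x) * qpoch_tail_sum q x))"
    by (intro sums_diff sums_mult qpoch_tail_sum_sums qpoch_tail_square_sums)
  also have "(\<lambda>n. q ^ n * qpoch_tail q x n - x * ((q\<^sup>2) ^ n * qpoch_tail q x n)) =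
     (\<lambda>n. q ^ n * (qpoch q (x * q ^ n) * qpoch q (q ^ (n + 1) / x)))"
  proof
    fix n
    have "qpoch q (x * q ^ n) = (1 - x * q ^ n) * qpoch q (x * q ^ (n + 1))"
      using qpoch_rec[OF q(1), of "x * q ^ n"] by (simp add: mult_ac)
    thus "q ^ n * qpoch_tail q x n - x * ((q\<^sup>2) ^ n * qpoch_tail q x n) =
        q ^ n * (qpoch q (x * q ^ n) * qpoch q (q ^ (n + 1) / x))"
      by (simp only: qpoch_tail_def) (simp add: algebra_simps flip: power_mult power_add mult_2 mult_2_right)
  qed
  also have "qpoch_tail_sum q x - x * (qpoch q x * qpoch q (1 / x) - 1 + (x + 1 / x) * qpoch_tail_sum q x) =
      x - x * (qpoch q x * qpoch q (1 / x)) - x\<^sup>2 * qpoch_tail_sum q x"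
    using x by (simp add: algebra_simps power2_eq_square)
  finally show ?thesis .
qed

lemma qpoch_tail_sum_inverse: "qpoch_tail_sum q (1 / x) = qpoch_tail_sum q x"
  by (simp add: qpoch_tail_sum_def qpoch_tail_def mult.commute)

text \<open>The shift drops the factor 1 - x from one product and adds 1 - 1/x = - (1 - x) / x to
  the other.\<close>

lemma theta_shift: "theta q (x * q) = - theta q x / x"
proof -
  have "theta q (x * q) = qpoch q (x * q) * ((1 - 1 / x) * qpoch q (q / x))"
    using qpoch_rec[OF q(1), of "1 / x"] q by (simp add: theta_def)
  moreover have "theta q x = (1 - x) * qpoch q (x * q) * qpoch q (q / x)"
    unfolding theta_def qpoch_rec[OF q(1), of x] ..
  moreover have "x * (1 - 1 / x) = - (1 - x)"
    using x by (simp add: algebra_simps)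
  ultimately have "x * theta q (x * q) = - theta q x"
    by (metis (no_types, opaque_lifting) mult.assoc mult.left_commute mult_minus_left)
  thus ?thesis
    using x by (simp add: field_simps)
qed

lemma theta_inverse: "qpoch q x * qpoch q (1 / x) = (1 - 1 / x) * theta q x"
  using qpoch_rec[OF q(1), of "1 / x"] by (simp add: theta_def)

end

section \<open>The functional equation between \<open>x\<close> and \<open>x * q\<close>\<close>

context
  fixes q x :: complex
  assumes q: "norm q < 1" "q \<noteq> 0" and x: "x \<noteq> 0"
begin

text \<open>The half-shifted series at 1/x and at x q agree term by term, both having terms q^n (q^n
  / x; q) (x q^(n+1); q). Equating their two evaluations, and using the symmetry under x -> 1/x and
  \<open>theta_shift\<close>, gives the recurrence.\<close>

lemma qpoch_tail_sum_rec:
  "qpoch_tail_sum q x = x ^ 4 * q\<^sup>2 * qpoch_tail_sum q (x * q) + (x - x ^ 3 * q) + theta q x * (1 - x\<^sup>2 * q)"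
proof -
  define y where "y = x * q"
  have y: "y \<noteq> 0" using q x by (simp add: y_def)
  have "(\<lambda>n. q ^ n * (qpoch q (1 / x * q ^ n) * qpoch q (q ^ (n + 1) / (1 / x)))) sums
     (1 / x - 1 / x * (qpoch q (1 / x) * qpoch q (1 / (1 / x))) - (1 / x)\<^sup>2 * qpoch_tail_sum q (1 / x))"
    using q x by (intro shifted_qpoch_tail_sums) auto
  moreover have "(\<lambda>n. q ^ n * (qpoch q (y * q ^ n) * qpoch q (q ^ (n + 1) / y))) sums
     (y - y * (qpoch q y * qpoch q (1 / y)) - y\<^sup>2 * qpoch_tail_sum q y)"
    using q y by (intro shifted_qpoch_tail_sums) auto
  moreover have "(\<lambda>n. q ^ n * (qpoch q (1 / x * q ^ n) * qpoch q (q ^ (n + 1) / (1 / x)))) =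
    (\<lambda>n. q ^ n * (qpoch q (y * q ^ n) * qpoch q (q ^ (n + 1) / y)))"
    using q x by (simp add: y_def mult_ac)
  ultimately have eq: "1 / x - 1 / x * (qpoch q (1 / x) * qpoch q (1 / (1 / x))) - (1 / x)\<^sup>2 * qpoch_tail_sum q (1 / x)
     = y - y * (qpoch q y * qpoch q (1 / y)) - y\<^sup>2 * qpoch_tail_sum q y"
    by (simp only: sums_unique2)
  have "qpoch q y * qpoch q (1 / y) = (1 - 1 / y) * theta q y"
    using q y by (intro theta_inverse)
  also have "theta q y = - theta q x / x"
    unfolding y_def using q x by (intro theta_shift)
  finally have th: "qpoch q y * qpoch q (1 / y) = (1 - 1 / y) * (- theta q x / x)" .
  have "qpoch q (1 / x) * qpoch q (1 / (1 / x)) = (1 - 1 / x) * theta q x"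
    using theta_inverse[OF q x] by (simp add: mult.commute)
  with eq th have "1 / x - 1 / x * ((1 - 1 / x) * theta q x) - (1 / x)\<^sup>2 * qpoch_tail_sum q x
     = y - y * ((1 - 1 / y) * (- theta q x / x)) - y\<^sup>2 * qpoch_tail_sum q y"
    using qpoch_tail_sum_inverse[OF q x] by simp
  \<comment> \<open>Naming the inverses turns the relation into a polynomial identity that
    \<open>algebra\<close> can handle.\<close>
  moreover define u v where "u = 1 / x" and "v = 1 / y"
  ultimately have "u - u * ((1 - u) * theta q x) - u\<^sup>2 * qpoch_tail_sum q x
     = y - y * ((1 - v) * (- theta q x * u)) - y\<^sup>2 * qpoch_tail_sum q y"
    by simp
  moreover have "u * x = 1" "v * y = 1"
    using x y by (simp_all add: u_def v_def)
  ultimately have "x - (x - 1) * theta q x - qpoch_tail_sum q x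
     = y * x\<^sup>2 + (y - 1) * (theta q x * x) - y\<^sup>2 * x\<^sup>2 * qpoch_tail_sum q y"
    by algebra
  hence "qpoch_tail_sum q x = x - (x - 1) * theta q x - (y * x\<^sup>2 + (y - 1) * (theta q x * x) - y\<^sup>2 * x\<^sup>2 * qpoch_tail_sum q y)"
    by (simp add: algebra_simps)
  thus ?thesis
    unfolding y_def by (simp add: algebra_simps eval_nat_numeral)
qed

text \<open>Iterating \<open>theta_shift\<close> naturally gives the exponent n(n-1)/2. Multiplying
  by q^n turns it into \<open>tri n\<close> and keeps the statement free of division and truncated
  subtraction.\<close>

lemma theta_shift_power: "theta q (x * q ^ n) * (x ^ n * q ^ tri n) = (-1) ^ n * q ^ n * theta q x"
proof (induction n)
  case (Suc n)
  have "theta q (x * q ^ Suc n) * (x * q ^ n) = - theta q (x * q ^ n)"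
    using theta_shift[OF q, of "x * q ^ n"] q x by (simp add: mult_ac)
  moreover have "x ^ Suc n * q ^ tri (Suc n) = (x * q ^ n) * (x ^ n * q ^ tri n) * q"
    by (simp add: power_add)
  ultimately have "theta q (x * q ^ Suc n) * (x ^ Suc n * q ^ tri (Suc n)) =
        - (theta q (x * q ^ n) * (x ^ n * q ^ tri n)) * q"
    by (metis (no_types, opaque_lifting) mult.assoc mult_minus_left)
  thus ?case
    using Suc.IH by (simp add: mult_ac)
qed simp

end

text \<open>Terms k = 2n and k = 2n+1 of the partial theta series with terms (-1)^k x^(2k+1) q^(tri
  k). They are paired because one use of the functional equation contributes both.\<close>

definition partial_theta :: "complex \<Rightarrow> complex \<Rightarrow> nat \<Rightarrow> complex" where
  "partial_theta q x n = x ^ (4 * n + 1) * q ^ tri (2 * n) - x ^ (4 * n + 3) * q ^ tri (2 * n + 1)"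

text \<open>The exponent below is \<open>n * n + tri n = n (3 n + 1) / 2\<close>.\<close>

definition theta_cofactor :: "complex \<Rightarrow> complex \<Rightarrow> nat \<Rightarrow> complex" where
  "theta_cofactor q x n = (-1) ^ n * x ^ (3 * n) * q ^ (n * n + tri n) * (1 - x\<^sup>2 * q ^ (2 * n + 1))"

section \<open>Iteration of the functional equation and decay of the remainder\<close>

context
  fixes q x :: complex
  assumes q: "norm q < 1" "q \<noteq> 0" and x: "x \<noteq> 0"
begin

text \<open>The prefactors (x q^k)^4 q^2 for k < N multiply to x^(4N) q^(2 N^2), and
  \<open>theta_shift_power\<close> reduces every theta value met on the way to
  \<open>theta q x\<close>.\<close>

lemma qpoch_tail_sum_iterate:
  "qpoch_tail_sum q x = (\<Sum>n<N. partial_theta q x n) + theta q x * (\<Sum>n<N. theta_cofactor q x n)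
     + x ^ (4 * N) * q ^ (2 * N * N) * qpoch_tail_sum q (x * q ^ N)"
proof (induction N)
  case (Suc N)
  have tri2: "tri (2 * N) = 2 * N * N + N"
    using two_tri[of "2 * N"] by simp
  \<comment> \<open>The recurrence at x z, with z standing for q^N, multiplied by the accumulated
    prefactor X Q.\<close>
  have gen: "X * Q * S = X * x ^ 4 * (Q * z ^ 4 * q\<^sup>2) * S' + (X * x * (Q * z) - X * x ^ 3 * (Q * z ^ 3 * q))
      + X * Q * T * (1 - (x * z)\<^sup>2 * q)"
    if "S = (x * z) ^ 4 * q\<^sup>2 * S' + (x * z - (x * z) ^ 3 * q) + T * (1 - (x * z)\<^sup>2 * q)"
    for X Q S S' z T
    using that by algebra
  have rec: "qpoch_tail_sum q (x * q ^ N) = (x * q ^ N) ^ 4 * q\<^sup>2 * qpoch_tail_sum q (x * q ^ N * q)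
      + (x * q ^ N - (x * q ^ N) ^ 3 * q) + theta q (x * q ^ N) * (1 - (x * q ^ N)\<^sup>2 * q)"
    using q x by (intro qpoch_tail_sum_rec) auto
  have Suc_pow: "x ^ (4 * Suc N) = x ^ (4 * N) * x ^ 4" "x ^ (4 * N + 1) = x ^ (4 * N) * x"
    "x ^ (4 * N + 3) = x ^ (4 * N) * x ^ 3"
    "q ^ (2 * Suc N * Suc N) = q ^ (2 * N * N) * (q ^ N) ^ 4 * q\<^sup>2"
    by (simp_all add: algebra_simps flip: power_add power_mult)
  have tri_pow: "q ^ tri (2 * N) = q ^ (2 * N * N) * q ^ N"
     "q ^ tri (2 * N + 1) = q ^ (2 * N * N) * (q ^ N) ^ 3 * q"
    unfolding Suc_eq_plus1[symmetric] tri_Suc tri2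
    by (simp_all add: power_add mult_ac eval_nat_numeral flip: power_mult)
  have xq: "x * q ^ Suc N = x * q ^ N * q" by simp
  have "x ^ (4 * N) * q ^ (2 * N * N) * qpoch_tail_sum q (x * q ^ N) =
     x ^ (4 * Suc N) * q ^ (2 * Suc N * Suc N) * qpoch_tail_sum q (x * q ^ Suc N) + partial_theta q x N
     + x ^ (4 * N) * q ^ (2 * N * N) * theta q (x * q ^ N) * (1 - (x * q ^ N)\<^sup>2 * q)"
    using gen[OF rec, of "x ^ (4 * N)" "q ^ (2 * N * N)"] unfolding partial_theta_def Suc_pow tri_pow xq .
  moreover have "x ^ (4 * N) * q ^ (2 * N * N) * theta q (x * q ^ N) =
     theta q x * ((-1) ^ N * x ^ (3 * N) * q ^ (N * N + tri N))"
  proof -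
    \<comment> \<open>This splits off the q^(tri N) that \<open>theta_shift_power\<close> absorbs.
      The extra q^N matches the one on the right of that lemma and is cancelled at the end.\<close>
    have e: "2 * N * N + N = (N * N + tri N) + tri N" using two_tri[of N] by (simp add: algebra_simps)
    have "q ^ (2 * N * N) * q ^ N = q ^ (N * N + tri N) * q ^ tri N"
      by (simp only: e flip: power_add)
    moreover have "x ^ (4 * N) = x ^ (3 * N) * x ^ N"
      by (simp flip: power_add)
    moreover have "X4 * Q * T * z = X3 * R * (T * (X * w))" if "Q * z = R * w" "X4 = X3 * X"
      for X4 X3 X Q R T z w :: complex
      using that by algebra
    ultimately have "x ^ (4 * N) * q ^ (2 * N * N) * theta q (x * q ^ N) * q ^ N
      = x ^ (3 * N) * q ^ (N * N + tri N) * (theta q (x * q ^ N) * (x ^ N * q ^ tri N))"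
      by blast
    also have "\<dots> = theta q x * ((-1) ^ N * x ^ (3 * N) * q ^ (N * N + tri N)) * q ^ N"
      unfolding theta_shift_power[OF q x] by (simp add: mult_ac)
    finally show ?thesis using q by simp
  qed
  ultimately have "x ^ (4 * N) * q ^ (2 * N * N) * qpoch_tail_sum q (x * q ^ N) =
     x ^ (4 * Suc N) * q ^ (2 * Suc N * Suc N) * qpoch_tail_sum q (x * q ^ Suc N) + partial_theta q x N
     + theta q x * theta_cofactor q x N"
    by (simp add: theta_cofactor_def power_mult_distrib mult_ac flip: power_mult)
  with Suc.IH show ?case
    by (simp add: algebra_simps)
qed simp

text \<open>Only the first N factors can be large: 1 - a / q^k is bounded by (1 + |a|) / |q|^k for k
  = 1, ..., N, and these denominators multiply to |q|^(tri N). The other factors form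
  \<open>qpoch q a\<close>.\<close>

lemma norm_qpoch_divide_le:
  "norm (qpoch q (a / q ^ N)) \<le> (1 + norm a) ^ N / norm q ^ tri N * exp (norm a / (1 - norm q))"
proof (induction N)
  case 0
  show ?case using norm_qpoch_le[OF q(1) order.refl] by simp
next
  case (Suc N)
  have "qpoch q (a / q ^ Suc N) = (1 - a / q ^ Suc N) * qpoch q (a / q ^ N)"
    using qpoch_rec[OF q(1), of "a / q ^ Suc N"] q by simp
  moreover have "norm (1 - a / q ^ Suc N) \<le> (1 + norm a) / norm q ^ Suc N"
  proof -
    have "norm (1 - a / q ^ Suc N) \<le> 1 + norm a / norm q ^ Suc N"
      using norm_triangle_ineq4[of 1 "a / q ^ Suc N"] by (simp only: norm_divide norm_power norm_one)
    also have "1 \<le> 1 / norm q ^ Suc N"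
      using q by (simp add: power_le_one del: power_Suc)
    finally show ?thesis
      by (simp add: add_divide_distrib)
  qed
  ultimately have "norm (qpoch q (a / q ^ Suc N)) \<le>
      (1 + norm a) / norm q ^ Suc N * ((1 + norm a) ^ N / norm q ^ tri N * exp (norm a / (1 - norm q)))"
    using Suc.IH by (simp only: norm_mult) (intro mult_mono, auto)
  thus ?case
    by (simp add: power_add mult_ac)
qed

lemma norm_qpoch_tail_sum_shift_le:
  "norm (qpoch_tail_sum q (x * q ^ N)) \<le> (1 + 1 / norm x) ^ N / norm q ^ tri N
     * (exp (norm x / (1 - norm q)) * exp (1 / norm x / (1 - norm q)) / (1 - norm q))"
proof -
  define E where "E = exp (norm x / (1 - norm q)) * exp (1 / norm x / (1 - norm q))"
  define K where "K = (1 + 1 / norm x) ^ N / norm q ^ tri N * E"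
  have bound: "norm (qpoch_tail q (x * q ^ N) n) \<le> K" for n
  proof -
    have le1: "norm q ^ m \<le> 1" for m
      using q by (intro power_le_one) auto
    have "norm (x * q ^ N * q ^ (n + 1)) \<le> norm x"
      using mult_left_mono[OF le1[of "N + (n + 1)"], of "norm x"]
      by (simp add: norm_mult norm_power power_add mult_ac)
    hence 1: "norm (qpoch q (x * q ^ N * q ^ (n + 1))) \<le> exp (norm x / (1 - norm q))"
      using q by (intro norm_qpoch_le)
    define a where "a = q ^ (n + 1) / x"
    have a: "norm a \<le> 1 / norm x"
      using divide_right_mono[OF le1[of "n + 1"], of "norm x"]
      by (simp add: a_def norm_divide norm_power del: power_Suc)
    have "norm (qpoch q (a / q ^ N)) \<le> (1 + norm a) ^ N / norm q ^ tri N * exp (norm a / (1 - norm q))"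
      by (rule norm_qpoch_divide_le)
    also have "\<dots> \<le> (1 + 1 / norm x) ^ N / norm q ^ tri N * exp (1 / norm x / (1 - norm q))"
    proof -
      have "norm a / (1 - norm q) \<le> 1 / norm x / (1 - norm q)"
        using a q by (intro divide_right_mono) auto
      thus ?thesis
        using a by (intro mult_mono divide_right_mono power_mono) auto
    qed
    finally have 2: "norm (qpoch q (a / q ^ N)) \<le> \<dots>" .
    have "qpoch_tail q (x * q ^ N) n = qpoch q (x * q ^ N * q ^ (n + 1)) * qpoch q (a / q ^ N)"
      by (simp add: qpoch_tail_def a_def)
    hence "norm (qpoch_tail q (x * q ^ N) n) \<le> exp (norm x / (1 - norm q)) *
       ((1 + 1 / norm x) ^ N / norm q ^ tri N * exp (1 / norm x / (1 - norm q)))"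
      using mult_mono[OF 1 2] by (simp add: norm_mult)
    thus ?thesis by (simp add: K_def E_def mult_ac)
  qed
  have "norm (qpoch_tail_sum q (x * q ^ N)) \<le> (\<Sum>n. norm q ^ n * K)"
    unfolding qpoch_tail_sum_def
  proof (rule norm_suminf_le)
    show "norm (q ^ n * qpoch_tail q (x * q ^ N) n) \<le> norm q ^ n * K" for n
      unfolding norm_mult norm_power using bound by (intro mult_left_mono) auto
    show "summable (\<lambda>n. norm q ^ n * K)"
      using q by (intro summable_mult2 summable_geometric) auto
  qed
  also have "\<dots> = 1 / (1 - norm q) * K"
    using q by (subst suminf_mult2[symmetric]) (auto simp: suminf_geometric intro!: summable_geometric)
  finally show ?thesis
    by (simp add: K_def E_def mult_ac)
qed

lemma tri_le_square: "tri N \<le> N * N"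
  by (induction N) auto

text \<open>The tail sum at x q^N may grow like |q|^(- tri N), but tri N <= N^2, so the prefactor
  q^(2 N^2) still leaves |q|^(N^2). The bound becomes (c |q|^N)^N times a constant, whose base
  eventually drops below 1/2.\<close>

lemma qpoch_tail_sum_remainder:
  "(\<lambda>N. x ^ (4 * N) * q ^ (2 * N * N) * qpoch_tail_sum q (x * q ^ N)) \<longlonglongrightarrow> 0"
proof -
  define E where "E = exp (norm x / (1 - norm q)) * exp (1 / norm x / (1 - norm q)) / (1 - norm q)"
  define c where "c = norm x ^ 4 * (1 + 1 / norm x)"
  have c: "c \<ge> 0" and E: "E \<ge> 0" using q by (auto simp: c_def E_def)
  have bound: "norm (x ^ (4 * N) * q ^ (2 * N * N) * qpoch_tail_sum q (x * q ^ N)) \<le> (c * norm q ^ N) ^ N * E" for N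
  proof -
    have "norm (x ^ (4 * N) * q ^ (2 * N * N) * qpoch_tail_sum q (x * q ^ N))
       \<le> norm x ^ (4 * N) * norm q ^ (2 * N * N) * ((1 + 1 / norm x) ^ N / norm q ^ tri N * E)"
      unfolding norm_mult norm_power E_def by (intro mult_left_mono norm_qpoch_tail_sum_shift_le) auto
    also have "\<dots> = c ^ N * (norm q ^ (2 * N * N) / norm q ^ tri N) * E"
      by (simp add: c_def power_mult_distrib power_mult)
    also have "norm q ^ (2 * N * N) / norm q ^ tri N = norm q ^ (2 * N * N - tri N)"
      using q tri_le_square[of N] by (simp add: power_diff)
    also have "\<dots> \<le> norm q ^ (N * N)"
      using q tri_le_square[of N] by (intro power_decreasing) auto
    finally show ?thesis
      using c E by (simp add: power_mult_distrib power_mult mult_left_mono mult_right_mono)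
  qed
  have "(\<lambda>N. c * norm q ^ N) \<longlonglongrightarrow> c * 0"
    using q by (intro tendsto_intros LIMSEQ_power_zero) auto
  hence "eventually (\<lambda>N. c * norm q ^ N < 1 / 2) sequentially"
    by (rule order_tendstoD) auto
  hence "eventually (\<lambda>N. norm (x ^ (4 * N) * q ^ (2 * N * N) * qpoch_tail_sum q (x * q ^ N)) \<le> (1 / 2) ^ N * E) sequentially"
  proof eventually_elim
    case (elim N)
    have "(c * norm q ^ N) ^ N * E \<le> (1 / 2) ^ N * E"
      using elim c E by (intro mult_right_mono power_mono) auto
    thus ?case using bound[of N] by linarith
  qed
  moreover have "(\<lambda>N. (1 / 2) ^ N * E) \<longlonglongrightarrow> 0"
    by (intro tendsto_mult_left_zero LIMSEQ_power_zero) auto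
  ultimately show ?thesis
    by (rule Lim_null_comparison)
qed

lemma qpoch_tail_sum_expansion:
  "(\<lambda>n. partial_theta q x n + theta q x * theta_cofactor q x n) sums qpoch_tail_sum q x"
proof -
  have "(\<Sum>n<N. partial_theta q x n + theta q x * theta_cofactor q x n) =
     qpoch_tail_sum q x - x ^ (4 * N) * q ^ (2 * N * N) * qpoch_tail_sum q (x * q ^ N)" for N
    using qpoch_tail_sum_iterate[of N] by (simp add: sum.distrib sum_distrib_left algebra_simps)
  moreover have "(\<lambda>N. qpoch_tail_sum q x - x ^ (4 * N) * q ^ (2 * N * N) * qpoch_tail_sum q (x * q ^ N))
      \<longlonglongrightarrow> qpoch_tail_sum q x - 0"
    by (intro tendsto_diff tendsto_const qpoch_tail_sum_remainder)
  ultimately show ?thesis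
    by (simp add: sums_def)
qed

end

section \<open>Generating functions over multisets\<close>

lemma has_sum_product_nonneg:
  fixes f :: "'a \<Rightarrow> real" and g :: "'b \<Rightarrow> real"
  assumes f: "(f has_sum a) A" "\<And>x. x \<in> A \<Longrightarrow> f x \<ge> 0"
    and g: "(g has_sum b) B" "\<And>y. y \<in> B \<Longrightarrow> g y \<ge> 0"
  shows "((\<lambda>(x, y). f x * g y) has_sum a * b) (A \<times> B)"
proof (rule has_sum_SigmaI)
  show inner: "((\<lambda>y. case (x, y) of (x, y) \<Rightarrow> f x * g y) has_sum f x * b) B" for x
    using has_sum_cmult_right[OF g(1)] by simp
  show outer: "((\<lambda>x. f x * b) has_sum a * b) A"
    using has_sum_cmult_left[OF f(1)] by simp
  show "(\<lambda>(x, y). f x * g y) summable_on A \<times> B"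
  proof (rule summable_on_SigmaI)
    show "(\<lambda>x. f x * b) summable_on A"
      using outer by (auto simp: summable_on_def)
  qed (use inner f g in auto)
qed

text \<open>The function \<open>key\<close> recovers the index, so the sets \<open>Y j\<close> are
  disjoint and their union is in bijection with the disjoint sum. Nonnegativity makes the order of
  summation irrelevant.\<close>

lemma has_sum_UN_nonneg:
  fixes f :: "'a \<Rightarrow> real"
  assumes f: "\<And>j. (f has_sum g j) (Y j)" and g: "g sums S"
    and nonneg: "\<And>x. f x \<ge> 0" and key: "\<And>j x. x \<in> Y j \<Longrightarrow> key x = j"
  shows "(f has_sum S) (\<Union>j. Y j)"
proof -
  have "((\<lambda>(j, x). f x) has_sum S) (Sigma UNIV Y)"
  proof (rule has_sum_SigmaI)
    show inner: "((\<lambda>y. case (j, y) of (j, x) \<Rightarrow> f x) has_sum g j) (Y j)" for j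
      using f by simp
    have "g j \<ge> 0" for j
      using has_sum_nonneg[OF f] nonneg by blast
    thus "(g has_sum S) UNIV"
      by (intro sums_nonneg_imp_has_sum g)
    thus "(\<lambda>(j, x). f x) summable_on Sigma UNIV Y"
      by (intro summable_on_SigmaI[OF inner]) (auto simp: summable_on_def nonneg)
  qed
  also have "((\<lambda>(j, x). f x) has_sum S) (Sigma UNIV Y) \<longleftrightarrow> (f has_sum S) (\<Union>j. Y j)"
    by (rule has_sum_reindex_bij_witness[where i = "\<lambda>x. (key x, x)" and j = snd]) (auto simp: key)
  finally show ?thesis .
qed

text \<open>Monotone convergence: a finite subset of the union already lies in some
  \<open>Y N\<close>, so all finite sums are at most L. This passes from finitely many admissible
  parts to infinitely many.\<close>

lemma has_sum_incseq_nonneg: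
  fixes f :: "'a \<Rightarrow> real"
  assumes f: "\<And>N. (f has_sum s N) (Y N)" and Y: "incseq Y" and s: "s \<longlonglongrightarrow> L"
    and nonneg: "\<And>x. f x \<ge> 0"
  shows "(f has_sum L) (\<Union>N. Y N)"
proof -
  have "s M \<le> s N" if "M \<le> N" for M N
    using has_sum_mono2[OF f f, of M N] Y that nonneg by (auto simp: incseq_def)
  hence sL: "s N \<le> L" for N
    using s by (intro incseq_le) (auto simp: incseq_def)
  have fin: "sum f X \<le> L" if X: "finite X" "X \<subseteq> (\<Union>N. Y N)" for X
  proof -
    have "\<exists>N. X \<subseteq> Y N"
      using X
    proof (induction X)
      case (insert x X)
      then obtain M N where "X \<subseteq> Y N" "x \<in> Y M" by auto
      moreover have "Y N \<subseteq> Y (max M N)" "Y M \<subseteq> Y (max M N)"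
        using Y by (auto simp: incseq_def)
      ultimately show ?case by blast
    qed auto
    then obtain N where N: "X \<subseteq> Y N" ..
    have "sum f X \<le> s N"
      using has_sum_mono2[OF has_sum_finite[OF X(1)] f[of N]] N nonneg by auto
    thus ?thesis using sL[of N] by linarith
  qed
  have summable: "f summable_on (\<Union>N. Y N)"
    using fin nonneg
    by (intro nonneg_bounded_partial_sums_imp_summable_on[where C = L] eventually_finite_subsets_at_top_weakI) auto
  have "infsum f (\<Union>N. Y N) \<le> L"
    using fin by (intro infsum_le_finite_sums summable) auto
  moreover have "s N \<le> infsum f (\<Union>N. Y N)" for N
    using nonneg by (intro has_sum_mono2[OF f has_sum_infsum[OF summable]]) auto
  hence "L \<le> infsum f (\<Union>N. Y N)"
    using s by (intro LIMSEQ_le_const2) auto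
  ultimately show ?thesis
    using has_sum_infsum[OF summable] by (metis order.antisym)
qed

text \<open>Grouping by size gives the power series. The fibres are finite because a positive
  constant is not summable over an infinite set, so \<open>card\<close> really counts them.\<close>

lemma sums_card_fibres:
  fixes r :: real
  assumes X: "((\<lambda>P. r ^ sum_mset P) has_sum S) X" and r: "r > 0"
  shows "(\<lambda>n. real (card {P \<in> X. sum_mset P = n}) * r ^ n) sums S"
proof (rule has_sum_imp_sums)
  let ?Y = "\<lambda>n. {P \<in> X. sum_mset P = n}"
  have "((\<lambda>P. r ^ sum_mset P) has_sum S) X \<longleftrightarrow>
      ((\<lambda>(n, P). r ^ sum_mset P) has_sum S) (Sigma UNIV ?Y)"
    by (rule has_sum_reindex_bij_witness[where j = "\<lambda>P. (sum_mset P, P)" and i = snd]) auto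
  with X have *: "((\<lambda>(n, P). r ^ sum_mset P) has_sum S) (Sigma UNIV ?Y)"
    by blast
  have "finite (?Y n)" for n
  proof (rule ccontr)
    assume "infinite (?Y n)"
    moreover have "(\<lambda>P. r ^ sum_mset P) summable_on ?Y n"
      by (rule summable_on_subset_banach[OF has_sum_imp_summable[OF X]]) auto
    hence "(\<lambda>P. r ^ n) summable_on ?Y n"
      by (subst summable_on_cong[where g = "\<lambda>P. r ^ sum_mset P"]) auto
    ultimately show False
      using infsum_diverge_constant[of "?Y n" "r ^ n"] r by auto
  qed
  hence "((\<lambda>P. r ^ n) has_sum real (card (?Y n)) * r ^ n) (?Y n)" for n
    by (intro has_sum_constant)
  hence "((\<lambda>P. case (n, P) of (n, P) \<Rightarrow> r ^ sum_mset P) has_sum real (card (?Y n)) * r ^ n) (?Y n)" for n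
    by (subst has_sum_cong[where g = "\<lambda>P. r ^ n"]) auto
  from has_sum_SigmaD[OF * this]
  show "((\<lambda>n. real (card (?Y n)) * r ^ n) has_sum S) UNIV" .
qed

section \<open>Multisets with independently prescribed multiplicities\<close>

definition mults :: "nat set \<Rightarrow> (nat \<Rightarrow> nat set) \<Rightarrow> nat multiset set" where
  "mults S K = {P. set_mset P \<subseteq> S \<and> (\<forall>p\<in>S. count P p \<in> K p)}"

text \<open>Induction on S: a multiset over \<open>insert p S\<close> amounts to a multiplicity of p
  and a multiset over S, so the sum factors.\<close>

lemma has_sum_mults:
  fixes r :: real
  assumes "finite S" and r: "r \<ge> 0"
    and "\<And>p. p \<in> S \<Longrightarrow> ((\<lambda>k. r ^ (p * k)) has_sum g p) (K p)"
  shows "((\<lambda>P. r ^ sum_mset P) has_sum (\<Prod>p\<in>S. g p)) (mults S K)"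
  using assms(1,3)
proof (induction S)
  case empty
  have "mults {} K = {{#}}" by (auto simp: mults_def)
  thus ?case using has_sum_finite[of "{{#}}" "\<lambda>P. r ^ sum_mset P"] by simp
next
  case (insert p S)
  have "((\<lambda>(k, P). r ^ (p * k) * r ^ sum_mset P) has_sum g p * (\<Prod>p\<in>S. g p)) (K p \<times> mults S K)"
    using insert r by (intro has_sum_product_nonneg) auto
  also have "?this \<longleftrightarrow> ((\<lambda>P. r ^ sum_mset P) has_sum g p * (\<Prod>p\<in>S. g p)) (mults (insert p S) K)"
  proof (rule has_sum_reindex_bij_witness[where j = "\<lambda>(k, P). P + replicate_mset k p"
        and i = "\<lambda>Q. (count Q p, filter_mset (\<lambda>x. x \<noteq> p) Q)"])
    fix a assume a: "a \<in> K p \<times> mults S K"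
    obtain k P where kP: "a = (k, P)" by force
    with a insert.hyps have "p \<notin># P" by (auto simp: mults_def)
    hence 0: "count P p = 0" by (simp add: not_in_iff)
    show "(\<lambda>Q. (count Q p, filter_mset (\<lambda>x. x \<noteq> p) Q)) ((\<lambda>(k, P). P + replicate_mset k p) a) = a"
      using 0 by (auto simp: kP multiset_eq_iff)
    show "(\<lambda>(k, P). P + replicate_mset k p) a \<in> mults (insert p S) K"
      using a 0 insert.hyps by (auto simp: kP mults_def split: if_splits)
    show "r ^ sum_mset ((\<lambda>(k, P). P + replicate_mset k p) a) = (\<lambda>(k, P). r ^ (p * k) * r ^ sum_mset P) a"
      by (simp add: kP power_add mult_ac)
  next
    fix Q assume Q: "Q \<in> mults (insert p S) K"
    show "(\<lambda>(k, P). P + replicate_mset k p) (count Q p, filter_mset (\<lambda>x. x \<noteq> p) Q) = Q"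
      by (auto simp: multiset_eq_iff)
    show "(count Q p, filter_mset (\<lambda>x. x \<noteq> p) Q) \<in> K p \<times> mults S K"
      using Q insert.hyps by (auto simp: mults_def)
  qed simp
  finally show ?case
    using insert.hyps by simp
qed

text \<open>Removing one copy of the largest part 3J leaves parts at most 3J, those up to J used at
  most twice. Their generating function is the product of 1 - r^(3p) over p <= J divided by that of
  1 - r^p over p <= 3J. The numerator cancels the denominators with p divisible by 3.\<close>

lemma C3_sums:
  fixes r :: real
  assumes r: "0 < r" "r < 1"
    and S: "(\<lambda>j. r ^ (3 * Suc j) / (\<Prod>i<Suc j. (1 - r ^ (3 * i + 1)) * (1 - r ^ (3 * i + 2)))) sums S"
  shows "(\<lambda>n. real (C3 n) * r ^ n) sums S"
proof -
  \<comment> \<open>The index is shifted by one: a largest part 3 * 0 cannot occur, since 0 is not a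
    part.\<close>
  define Y where "Y = (\<lambda>j. {P. P \<noteq> {#} \<and> 0 \<notin># P \<and> Max_mset P = 3 * Suc j \<and> (\<forall>p\<in>#P. p \<le> Suc j \<longrightarrow> count P p < 3)})"
  define K where "K = (\<lambda>j p::nat. if p \<le> Suc j then {..<3} else (UNIV :: nat set))"
  have less1: "r ^ k < 1" if "k > 0" for k
    using r that by (simp add: power_less_one_iff)
  have prod_triples: "(\<Prod>p\<in>{1..3*j}. 1 - r ^ p) =
    (\<Prod>i<j. (1 - r ^ (3 * i + 1)) * (1 - r ^ (3 * i + 2))) * (\<Prod>p\<in>{1..j}. 1 - r ^ (3 * p))" for j
  proof (induction j)
    case (Suc j)
    have "{1..3 * Suc j} = insert (3*j+1) (insert (3*j+2) (insert (3*j+3) {1..3*j}))" by auto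
    thus ?case using Suc.IH by (simp add: mult_ac add_ac)
  qed simp
  have "((\<lambda>P. r ^ sum_mset P) has_sum r ^ (3 * Suc j) / (\<Prod>i<Suc j. (1 - r ^ (3 * i + 1)) * (1 - r ^ (3 * i + 2)))) (Y j)" for j
  proof -
    let ?g = "\<lambda>p. (if p \<le> Suc j then 1 - r ^ (3 * p) else 1) / (1 - r ^ p)"
    have "((\<lambda>k. r ^ (p * k)) has_sum ?g p) (K j p)" if p: "p \<in> {1..3 * Suc j}" for p
    proof (cases "p \<le> Suc j")
      case True
      have "(1 - r ^ (3 * p)) / (1 - r ^ p) = (\<Sum>k<3. r ^ (p * k))"
        using less1[of p] p by (simp add: field_simps eval_nat_numeral flip: power_add power_mult)
      thus ?thesis using True by (simp add: K_def has_sum_finite_iff)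
    next
      case False
      have "(\<lambda>k. (r ^ p) ^ k) sums (1 / (1 - r ^ p))"
        using less1[of p] p r by (intro geometric_sums) auto
      hence "((\<lambda>k. r ^ (p * k)) has_sum (1 / (1 - r ^ p))) UNIV"
        using r by (intro sums_nonneg_imp_has_sum) (auto simp: power_mult)
      thus ?thesis using False by (simp add: K_def)
    qed
    hence "((\<lambda>P. r ^ sum_mset P) has_sum prod ?g {1..3 * Suc j}) (mults {1..3 * Suc j} (K j))"
      using r by (intro has_sum_mults) auto
    from has_sum_cmult_right[OF this, of "r ^ (3 * Suc j)"]
    have "((\<lambda>P. r ^ (3 * Suc j) * r ^ sum_mset P) has_sum r ^ (3 * Suc j) * prod ?g {1..3 * Suc j}) (mults {1..3 * Suc j} (K j))" .
    also have "?this \<longleftrightarrow> ((\<lambda>P. r ^ sum_mset P) has_sum r ^ (3 * Suc j) * prod ?g {1..3 * Suc j}) (Y j)"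
    proof (rule has_sum_reindex_bij_witness[where j = "add_mset (3 * Suc j)" and i = "\<lambda>P. P - {#3 * Suc j#}"])
      fix P assume P: "P \<in> mults {1..3 * Suc j} (K j)"
      have "Max (insert (3 * Suc j) (set_mset P)) = 3 * Suc j"
        using P by (intro Max_eqI) (auto simp: mults_def)
      thus "add_mset (3 * Suc j) P \<in> Y j"
        using P by (force simp: Y_def mults_def K_def)
    next
      fix P assume P: "P \<in> Y j"
      hence mem: "3 * Suc j \<in># P"
        unfolding Y_def by (metis (mono_tags, lifting) Max_in finite_set_mset mem_Collect_eq set_mset_eq_empty_iff)
      thus "add_mset (3 * Suc j) (P - {#3 * Suc j#}) = P" by simp
      have "p \<le> 3 * Suc j" "p \<ge> 1" if "p \<in># P" for p
        using P that Max_ge[of "set_mset P" p] by (auto simp: Y_def Suc_le_eq intro: gr0I)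
      moreover have "count P p < 3" if "p \<le> Suc j" for p
        using P that by (cases "p \<in># P") (auto simp: Y_def not_in_iff)
      ultimately show "P - {#3 * Suc j#} \<in> mults {1..3 * Suc j} (K j)"
        by (auto simp: mults_def K_def dest: in_diffD)
    qed (simp_all add: power_add)
    also have "prod ?g {1..3 * Suc j} = 1 / (\<Prod>i<Suc j. (1 - r ^ (3 * i + 1)) * (1 - r ^ (3 * i + 2)))"
    proof -
      have "(\<Prod>p\<in>{1..3 * Suc j}. if p \<le> Suc j then 1 - r ^ (3 * p) else 1) = (\<Prod>p\<in>{1..Suc j}. 1 - r ^ (3 * p))"
        by (rule prod.mono_neutral_cong_right) auto
      moreover have "(\<Prod>p\<in>{1..Suc j}. 1 - r ^ (3 * p)) \<noteq> 0"
      proof -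
        have "r ^ (3 * p) \<noteq> 1" if "p \<in> {1..Suc j}" for p
          using less1[of "3 * p"] that by auto
        thus ?thesis unfolding prod_zero_iff[OF finite_atLeastAtMost] by (metis right_minus_eq)
      qed
      ultimately show ?thesis
        unfolding prod_dividef prod_triples by simp
    qed
    finally show ?thesis by simp
  qed
  hence "((\<lambda>P. r ^ sum_mset P) has_sum S) (\<Union>j. Y j)"
    using S by (rule has_sum_UN_nonneg[where key = "\<lambda>P. Max_mset P div 3 - 1"]) (use r in \<open>auto simp: Y_def\<close>)
  from sums_card_fibres[OF this r(1)] have "(\<lambda>n. real (card {P \<in> \<Union>j. Y j. sum_mset P = n}) * r ^ n) sums S" .
  moreover have "{P \<in> \<Union>j. Y j. sum_mset P = n} = {P \<in> partitions n. P \<noteq> {#} \<and>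
     (\<exists>j. Max_mset P = 3 * j \<and> (\<forall>p \<in># P. p \<le> j \<longrightarrow> count P p < 3))}" for n
  proof (intro set_eqI iffI)
    fix P assume "P \<in> {P \<in> partitions n. P \<noteq> {#} \<and>
     (\<exists>j. Max_mset P = 3 * j \<and> (\<forall>p \<in># P. p \<le> j \<longrightarrow> count P p < 3))}"
    then obtain j where j: "P \<noteq> {#}" "Max_mset P = 3 * j" "0 \<notin># P" "sum_mset P = n" "\<forall>p \<in># P. p \<le> j \<longrightarrow> count P p < 3"
      by (auto simp: partitions_def partitions_nonneg_def)
    hence "Max_mset P \<in># P" by (intro Max_in) auto
    hence "j \<noteq> 0" using j by (metis mult_0_right)
    then obtain i where "j = Suc i" by (cases j) auto
    with j show "P \<in> {P \<in> \<Union>j. Y j. sum_mset P = n}" by (auto simp: Y_def)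
  next
    fix P assume "P \<in> {P \<in> \<Union>j. Y j. sum_mset P = n}"
    then obtain j where "P \<in> Y j" "sum_mset P = n" by blast
    thus "P \<in> {P \<in> partitions n. P \<noteq> {#} \<and>
     (\<exists>j. Max_mset P = 3 * j \<and> (\<forall>p \<in># P. p \<le> j \<longrightarrow> count P p < 3))}"
      unfolding Y_def partitions_def partitions_nonneg_def by blast
  qed
  ultimately show ?thesis
    by (simp add: C3_def)
qed

text \<open>Removing the three copies of the smallest part m leaves parts above m, each used at most
  twice. The value m = 0 needs no separate treatment.\<close>

lemma D3_sums:
  fixes r :: real
  assumes r: "0 < r" "r < 1"
    and b: "\<And>m. (\<lambda>N. \<Prod>k<N. 1 + r ^ (m + 1 + k) + (r ^ (m + 1 + k))\<^sup>2) \<longlonglongrightarrow> b m"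
    and S: "(\<lambda>m. r ^ (3 * m) * b m) sums S"
  shows "(\<lambda>n. real (D3 n) * r ^ n) sums S"
proof -
  define Y where "Y = (\<lambda>m::nat. {P. P \<noteq> {#} \<and> Min_mset P = m \<and> count P m = 3 \<and> (\<forall>p\<in>#P. p \<noteq> m \<longrightarrow> count P p < 3)})"
  \<comment> \<open>Parts are capped at m + N because \<open>has_sum_mults\<close> needs finitely
    many of them; the infinite product arises as N grows.\<close>
  define Z where "Z = (\<lambda>m N::nat. mults {m<..m+N} (\<lambda>_. {..<3}))"
  have "((\<lambda>P. r ^ sum_mset P) has_sum r ^ (3 * m) * b m) (Y m)" for m
  proof -
    have "((\<lambda>P. r ^ sum_mset P) has_sum (\<Prod>k<N. 1 + r ^ (m + 1 + k) + (r ^ (m + 1 + k))\<^sup>2)) (Z m N)" for N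
    proof -
      have "((\<lambda>k. r ^ (p * k)) has_sum (1 + r ^ p + (r ^ p)\<^sup>2)) {..<3}" for p
        by (simp add: has_sum_finite_iff eval_nat_numeral flip: power_add power_mult)
      hence "((\<lambda>P. r ^ sum_mset P) has_sum (\<Prod>p\<in>{m<..m+N}. 1 + r ^ p + (r ^ p)\<^sup>2)) (Z m N)"
        unfolding Z_def using r by (intro has_sum_mults) auto
      also have "(\<Prod>p\<in>{m<..m+N}. 1 + r ^ p + (r ^ p)\<^sup>2) = (\<Prod>k<N. 1 + r ^ (m + 1 + k) + (r ^ (m + 1 + k))\<^sup>2)"
        by (rule prod.reindex_bij_witness[where i = "\<lambda>k. m + 1 + k" and j = "\<lambda>p. p - m - 1"]) auto
      finally show ?thesis .
    qed
    moreover have "incseq (Z m)"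
    proof (intro incseq_SucI subsetI)
      fix N P assume P: "P \<in> Z m N"
      have "count P p < 3" if "p > m" for p
        using P that by (cases "p \<in># P") (auto simp: Z_def mults_def not_in_iff)
      thus "P \<in> Z m (Suc N)" using P by (auto simp: Z_def mults_def)
    qed
    ultimately have "((\<lambda>P. r ^ sum_mset P) has_sum b m) (\<Union>N. Z m N)"
      using r by (intro has_sum_incseq_nonneg[OF _ _ b]) auto
    from has_sum_cmult_right[OF this, of "r ^ (3 * m)"]
    have "((\<lambda>P. r ^ (3 * m) * r ^ sum_mset P) has_sum r ^ (3 * m) * b m) (\<Union>N. Z m N)" .
    also have "?this \<longleftrightarrow> ((\<lambda>P. r ^ sum_mset P) has_sum r ^ (3 * m) * b m) (Y m)"
    proof (rule has_sum_reindex_bij_witness[where j = "\<lambda>P. P + replicate_mset 3 m" and i = "\<lambda>P. P - replicate_mset 3 m"])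
      fix P assume "P \<in> (\<Union>N. Z m N)"
      then obtain N where P: "P \<in> Z m N" by blast
      have "Min (insert m (set_mset P)) = m"
        using P by (intro Min_eqI) (auto simp: Z_def mults_def)
      moreover have "m \<notin># P" using P by (auto simp: Z_def mults_def)
      ultimately show "P + replicate_mset 3 m \<in> Y m"
        using P by (auto simp: Y_def Z_def mults_def not_in_iff)
      show "r ^ sum_mset (P + replicate_mset 3 m) = r ^ (3 * m) * r ^ sum_mset P"
        by (simp add: power_add)
    next
      fix P assume P: "P \<in> Y m"
      show "P - replicate_mset 3 m + replicate_mset 3 m = P"
        using P by (auto simp: Y_def multiset_eq_iff)
      have "p > m" if "p \<in># P - replicate_mset 3 m" for p
      proof -
        have "p \<in># P" using that by (rule in_diffD)
        hence "p \<ge> m" using P by (auto simp: Y_def)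
        moreover have "p \<noteq> m" using P that by (auto simp: Y_def simp flip: count_greater_zero_iff)
        ultimately show ?thesis by simp
      qed
      moreover have "count P p < 3" if "p > m" for p
        using P that by (cases "p \<in># P") (auto simp: Y_def not_in_iff)
      moreover have "p \<le> m + Max_mset P" if "p \<in># P - replicate_mset 3 m" for p
        using in_diffD[OF that] by (intro trans_le_add2 Max_ge) auto
      \<comment> \<open>The largest part serves as the cap N.\<close>
      ultimately have "P - replicate_mset 3 m \<in> Z m (Max_mset P)"
        by (auto simp: Z_def mults_def)
      thus "P - replicate_mset 3 m \<in> (\<Union>N. Z m N)" by blast
    qed simp_all
    finally show ?thesis .
  qed
  hence "((\<lambda>P. r ^ sum_mset P) has_sum S) (\<Union>m. Y m)"
    using S by (rule has_sum_UN_nonneg[where key = Min_mset]) (use r in \<open>auto simp: Y_def\<close>)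
  from sums_card_fibres[OF this r(1)]
  have "(\<lambda>n. real (card {P \<in> \<Union>m. Y m. sum_mset P = n}) * r ^ n) sums S" .
  moreover have "{P \<in> \<Union>m. Y m. sum_mset P = n} = {P \<in> partitions_nonneg n. P \<noteq> {#} \<and>
     count P (Min_mset P) = 3 \<and> (\<forall>p \<in># P. p \<noteq> Min_mset P \<longrightarrow> count P p < 3)}" for n
    by (auto simp: Y_def partitions_nonneg_def)
  ultimately show ?thesis
    by (simp add: D3_def)
qed

section \<open>Cube roots of unity and the two generating functions\<close>

text \<open>Some late tail is nonzero because the tails tend to 1, and finitely many nonzero factors
  remain.\<close>

lemma qpoch_nonzero:
  assumes q: "norm q < 1" and a: "\<And>k. a * q ^ k \<noteq> 1"
  shows "qpoch q a \<noteq> 0"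
proof -
  have "eventually (\<lambda>N. qpoch q (a * q ^ N) \<noteq> 0) sequentially"
    using qpoch_tendsto_1[OF q] by (rule tendsto_imp_eventually_ne) simp
  then obtain N where "qpoch q (a * q ^ N) \<noteq> 0"
    by (auto simp: eventually_sequentially)
  moreover have "(\<Prod>k<N. 1 - a * q ^ k) \<noteq> 0"
    using a by (simp add: prod_zero_iff)
  ultimately show ?thesis
    using qpoch_split[OF q, of a N] by simp
qed

text \<open>Exponents are sorted by residue modulo 3, taking the limit along partial products of
  length 3N.\<close>

lemma qpoch_trisection:
  assumes q: "norm q < 1"
  shows "qpoch q q = qpoch (q ^ 3) q * qpoch (q ^ 3) (q\<^sup>2) * qpoch (q ^ 3) (q ^ 3)"
proof -
  have q3: "norm (q ^ 3) < 1"
    using q by (simp add: norm_power power_less_one_iff)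
  have "(\<lambda>N. \<Prod>k<N. 1 - q * q ^ k) \<longlonglongrightarrow> qpoch q q"
    by (rule qpoch_LIMSEQ[OF q])
  hence "(\<lambda>N. \<Prod>k<3 * N. 1 - q * q ^ k) \<longlonglongrightarrow> qpoch q q"
    by (rule LIMSEQ_subseq_LIMSEQ[unfolded o_def, where f = "\<lambda>N. 3 * N"]) (auto simp: strict_mono_def)
  also have "(\<lambda>N. \<Prod>k<3 * N. 1 - q * q ^ k) = (\<lambda>N. (\<Prod>k<N. 1 - q * (q ^ 3) ^ k) *
      (\<Prod>k<N. 1 - q\<^sup>2 * (q ^ 3) ^ k) * (\<Prod>k<N. 1 - q ^ 3 * (q ^ 3) ^ k))"
  proof
    fix N
    show "(\<Prod>k<3 * N. 1 - q * q ^ k) = (\<Prod>k<N. 1 - q * (q ^ 3) ^ k) *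
      (\<Prod>k<N. 1 - q\<^sup>2 * (q ^ 3) ^ k) * (\<Prod>k<N. 1 - q ^ 3 * (q ^ 3) ^ k)"
    proof (induction N)
      case (Suc N)
      have e: "3 * Suc N = Suc (Suc (Suc (3 * N)))" by simp
      have "q * q ^ (3 * N) = q * (q ^ 3) ^ N" "q * q ^ Suc (3 * N) = q\<^sup>2 * (q ^ 3) ^ N"
        "q * q ^ Suc (Suc (3 * N)) = q ^ 3 * (q ^ 3) ^ N"
        by (simp_all add: power_mult power2_eq_square power3_eq_cube)
      thus ?case
        unfolding e prod.lessThan_Suc Suc.IH by (simp only: mult_ac)
    qed simp
  qed
  finally have "(\<lambda>N. (\<Prod>k<N. 1 - q * (q ^ 3) ^ k) *
      (\<Prod>k<N. 1 - q\<^sup>2 * (q ^ 3) ^ k) * (\<Prod>k<N. 1 - q ^ 3 * (q ^ 3) ^ k)) \<longlonglongrightarrow> qpoch q q" .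
  moreover have "(\<lambda>N. (\<Prod>k<N. 1 - q * (q ^ 3) ^ k) *
      (\<Prod>k<N. 1 - q\<^sup>2 * (q ^ 3) ^ k) * (\<Prod>k<N. 1 - q ^ 3 * (q ^ 3) ^ k))
      \<longlonglongrightarrow> qpoch (q ^ 3) q * qpoch (q ^ 3) (q\<^sup>2) * qpoch (q ^ 3) (q ^ 3)"
    by (intro tendsto_mult qpoch_LIMSEQ q3)
  ultimately show ?thesis
    by (rule LIMSEQ_unique)
qed

context
  fixes w :: complex
  assumes w: "w\<^sup>2 + w + 1 = 0"
begin

lemma cube_root_props: "w ^ 3 = 1" "w \<noteq> 0" "norm w = 1" "1 / w = w\<^sup>2"
proof -
  show 1: "w ^ 3 = 1" using w by algebra
  show 2: "w \<noteq> 0" using w by auto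
  have "norm w ^ 3 = 1" using 1 by (metis norm_one norm_power)
  thus "norm w = 1" using power_eq_1_iff by fastforce
  show "1 / w = w\<^sup>2" using 1 2 by (simp add: field_simps power2_eq_square power3_eq_cube)
qed

lemma qpoch_cube:
  assumes q: "norm q < 1"
  shows "qpoch q (w * q) * qpoch q (w\<^sup>2 * q) * qpoch q q = qpoch (q ^ 3) (q ^ 3)"
proof -
  have q3: "norm (q ^ 3) < 1"
    using q by (simp add: norm_power power_less_one_iff)
  have "(\<lambda>N. (\<Prod>k<N. 1 - w * q * q ^ k) * (\<Prod>k<N. 1 - w\<^sup>2 * q * q ^ k) * (\<Prod>k<N. 1 - q * q ^ k))
      \<longlonglongrightarrow> qpoch q (w * q) * qpoch q (w\<^sup>2 * q) * qpoch q q"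
    by (intro tendsto_mult qpoch_LIMSEQ q)
  moreover have "(1 - w * y) * (1 - w\<^sup>2 * y) * (1 - y) = 1 - y ^ 3" for y
    using w by algebra
  from this[of "q * q ^ k" for k]
  have "(1 - w * q * q ^ k) * (1 - w\<^sup>2 * q * q ^ k) * (1 - q * q ^ k) = 1 - q ^ 3 * (q ^ 3) ^ k" for k
    by (simp add: power_mult_distrib mult.assoc mult.commute[of k] flip: power_mult)
  hence "(\<Prod>k<N. 1 - w * q * q ^ k) * (\<Prod>k<N. 1 - w\<^sup>2 * q * q ^ k) * (\<Prod>k<N. 1 - q * q ^ k) =
     (\<Prod>k<N. 1 - q ^ 3 * (q ^ 3) ^ k)" for N
    by (simp flip: prod.distrib)
  ultimately show ?thesis
    using qpoch_LIMSEQ[OF q3, of "q ^ 3"] LIMSEQ_unique by simp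
qed

text \<open>By \<open>qpoch_cube\<close> the first two factors times (q; q) give (q^3; q^3), while
  by \<open>qpoch_trisection\<close> the last two times (q^3; q^3) give (q; q). The latter is
  nonzero, so both can be cancelled.\<close>

lemma qpoch_cube_root_inverse:
  assumes q: "norm q < 1"
  shows "qpoch q (w * q) * qpoch q (w\<^sup>2 * q) * (qpoch (q ^ 3) q * qpoch (q ^ 3) (q\<^sup>2)) = 1"
proof -
  have "q * q ^ k \<noteq> 1" for k
  proof
    assume "q * q ^ k = 1"
    hence "norm q ^ Suc k = 1" by (metis norm_one norm_power power_Suc)
    moreover have "norm q ^ Suc k < 1"
      using q by (simp add: power_less_one_iff del: power_Suc)
    ultimately show False by simp
  qed
  hence "qpoch q q \<noteq> 0"
    using q by (intro qpoch_nonzero)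
  moreover have "X * T = 1" if "X * E = F" "E = T * F" "E \<noteq> 0" for X T E F :: complex
  proof -
    have "X * T * F = F" "F \<noteq> 0"
      using that by (auto simp: mult.assoc)
    thus ?thesis by simp
  qed
  ultimately show ?thesis
    using qpoch_cube[OF q] qpoch_trisection[OF q] by blast
qed

text \<open>For a primitive cube root, T n is (1 + q^n + q^(2n)) times the tail. So q^n T n minus
  the tail with weights q^n and q^(2n) leaves the weight q^(3n), while the sum of q^n T n is T 0
  plus q times the tail sum by an index shift.\<close>

lemma qpoch_tail_cube_sums:
  assumes q: "norm q < 1" "q \<noteq> 0"
  shows "(\<lambda>n. (q ^ 3) ^ n * qpoch_tail q w n) sums (1 + q * qpoch_tail_sum q w)"
proof -
  note w' = cube_root_props
  define T where "T = (\<lambda>n. qpoch q (w * q ^ n) * qpoch q (q ^ n / w))"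
  have "(\<lambda>n. q ^ Suc n * T (Suc n)) sums (q * qpoch_tail_sum q w)"
    using sums_mult[OF qpoch_tail_sum_sums[OF q w'(2)], of q] by (simp add: T_def qpoch_tail_def mult_ac)
  hence "(\<lambda>n. q ^ n * T n) sums (q * qpoch_tail_sum q w + q ^ 0 * T 0)"
    by (rule sums_Suc)
  hence "(\<lambda>n. q ^ n * T n - q ^ n * qpoch_tail q w n - (q\<^sup>2) ^ n * qpoch_tail q w n) sums
     (q * qpoch_tail_sum q w + q ^ 0 * T 0 - qpoch_tail_sum q w - (qpoch q w * qpoch q (1 / w) - 1 + (w + 1 / w) * qpoch_tail_sum q w))"
    by (intro sums_diff qpoch_tail_sum_sums[OF q w'(2)] qpoch_tail_square_sums[OF q w'(2)])
  moreover have 1: "q ^ n * T n - q ^ n * qpoch_tail q w n - (q\<^sup>2) ^ n * qpoch_tail q w n = (q ^ 3) ^ n * qpoch_tail q w n" for n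
  proof -
    have "T n = (1 - w * q ^ n) * (1 - w\<^sup>2 * q ^ n) * qpoch_tail q w n"
      unfolding T_def qpoch_tail_step[OF q w'(2)] using w'(4) by (metis divide_inverse inverse_eq_divide mult.commute)
    also have "(1 - w * y) * (1 - w\<^sup>2 * y) = 1 + y + y\<^sup>2" for y
      using w by algebra
    finally show ?thesis
      by (simp add: algebra_simps eval_nat_numeral power_mult_distrib)
  qed
  \<comment> \<open>With this value the two unshifted copies of \<open>qpoch_tail_sum q w\<close>
    cancel.\<close>
  moreover have "w + 1 / w = -1"
    using w w'(4) by algebra
  hence 2: "q * qpoch_tail_sum q w + q ^ 0 * T 0 - qpoch_tail_sum q w - (qpoch q w * qpoch q (1 / w) - 1 + (w + 1 / w) * qpoch_tail_sum q w)
     = 1 + q * qpoch_tail_sum q w"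
    by (simp add: T_def)
  ultimately show ?thesis
    unfolding 1 2 by blast
qed

end

section \<open>From real generating functions to complex tail sums\<close>

lemma of_real_sumsD:
  assumes "(\<lambda>n. complex_of_real (t n)) sums L"
  shows "t sums Re L" "complex_of_real (Re L) = L"
proof -
  show 1: "t sums Re L"
    using sums_Re[OF assms] by simp
  show "complex_of_real (Re L) = L"
    using sums_of_real[OF 1, where ?'a = complex] assms by (rule sums_unique2)
qed

lemma D3_sums_qpoch_tail_sum:
  fixes r :: real
  assumes w: "w\<^sup>2 + w + 1 = 0" and r: "0 < r" "r < 1"
  defines "q \<equiv> complex_of_real r"
  shows "(\<lambda>n. of_nat (D3 n) * q ^ n) sums (1 + q * qpoch_tail_sum q w)"
proof -
  have q: "norm q < 1" "q \<noteq> 0" using r by (auto simp: q_def)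
  note w' = cube_root_props[OF w]
  let ?p = "\<lambda>m N. \<Prod>k<N. 1 + r ^ (m + 1 + k) + (r ^ (m + 1 + k))\<^sup>2"
  have lim: "(\<lambda>N. complex_of_real (?p m N)) \<longlonglongrightarrow> qpoch_tail q w m" for m
  proof -
    have "(\<lambda>N. (\<Prod>k<N. 1 - w * q ^ (m + 1) * q ^ k) * (\<Prod>k<N. 1 - q ^ (m + 1) / w * q ^ k)) \<longlonglongrightarrow> qpoch_tail q w m"
      unfolding qpoch_tail_def by (intro tendsto_mult qpoch_LIMSEQ q)
    moreover have "(1 - w * q ^ (m + 1) * q ^ k) * (1 - q ^ (m + 1) / w * q ^ k)
        = complex_of_real (1 + r ^ (m + 1 + k) + (r ^ (m + 1 + k))\<^sup>2)" for k
    proof -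
      have "(1 - w * y) * (1 - w\<^sup>2 * y) = 1 + y + y\<^sup>2" for y
        using w by algebra
      from this[of "q ^ (m + 1 + k)"]
      have "(1 - w * q ^ (m + 1 + k)) * (1 - w\<^sup>2 * q ^ (m + 1 + k)) = complex_of_real (1 + r ^ (m + 1 + k) + (r ^ (m + 1 + k))\<^sup>2)"
        by (simp add: q_def)
      moreover have "w * q ^ (m + 1) * q ^ k = w * q ^ (m + 1 + k)"
        by (simp add: power_add)
      moreover have "q ^ (m + 1) / w * q ^ k = 1 / w * q ^ (m + 1 + k)"
        by (simp add: power_add)
      ultimately show ?thesis
        unfolding w'(4) by (simp only:)
    qed
    ultimately show ?thesis
      by (simp flip: prod.distrib)
  qed
  have lim_Re: "?p m \<longlonglongrightarrow> Re (qpoch_tail q w m)" for m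
    using tendsto_Re[OF lim] unfolding Re_complex_of_real .
  have re: "complex_of_real (Re (qpoch_tail q w m)) = qpoch_tail q w m" for m
  proof -
    have "(\<lambda>N. complex_of_real (?p m N)) \<longlonglongrightarrow> complex_of_real (Re (qpoch_tail q w m))"
      by (intro tendsto_of_real lim_Re)
    thus ?thesis using lim by (rule LIMSEQ_unique)
  qed
  have "(\<lambda>m. (q ^ 3) ^ m * qpoch_tail q w m) sums (1 + q * qpoch_tail_sum q w)"
    by (rule qpoch_tail_cube_sums[OF w q])
  also have "(\<lambda>m. (q ^ 3) ^ m * qpoch_tail q w m) = (\<lambda>m. complex_of_real (r ^ (3 * m) * Re (qpoch_tail q w m)))"
    by (simp add: re power_mult q_def[symmetric])
  finally have S: "(\<lambda>m. complex_of_real (r ^ (3 * m) * Re (qpoch_tail q w m))) sums (1 + q * qpoch_tail_sum q w)" .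
  have "(\<lambda>n. real (D3 n) * r ^ n) sums Re (1 + q * qpoch_tail_sum q w)"
    by (rule D3_sums[OF r lim_Re of_real_sumsD(1)[OF S]])
  hence "(\<lambda>n. complex_of_real (real (D3 n) * r ^ n)) sums complex_of_real (Re (1 + q * qpoch_tail_sum q w))"
    by (rule sums_of_real)
  thus ?thesis
    unfolding of_real_sumsD(2)[OF S] by (simp add: q_def)
qed

text \<open>Each finite denominator in \<open>C3_sums\<close> is a quotient of infinite products, so
  its reciprocal is P (q^(3n+1); q^3) (q^(3n+2); q^3). The series is therefore P times the
  half-shifted series with base q^3 and x = q.\<close>

lemma C3_sums_qpoch_tail_sum:
  fixes r :: real
  assumes r: "0 < r" "r < 1"
  defines "q \<equiv> complex_of_real r"
  assumes P: "P * (qpoch (q ^ 3) q * qpoch (q ^ 3) (q\<^sup>2)) = 1"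
  shows "(\<lambda>n. of_nat (C3 n) * q ^ n) sums (P * (q - q\<^sup>2 * qpoch_tail_sum (q ^ 3) q) - q)"
proof -
  have q: "norm q < 1" "q \<noteq> 0" using r by (auto simp: q_def)
  have q3: "norm (q ^ 3) < 1" "q ^ 3 \<noteq> 0"
    using q by (simp_all add: norm_power power_less_one_iff)
  define Th where "Th = qpoch (q ^ 3) q * qpoch (q ^ 3) (q\<^sup>2)"
  define T where "T = (\<lambda>n. (q ^ 3) ^ n * (qpoch (q ^ 3) (q * (q ^ 3) ^ n) * qpoch (q ^ 3) ((q ^ 3) ^ (n + 1) / q)))"
  define d where "d = (\<lambda>n. \<Prod>i<n. (1 - r ^ (3 * i + 1)) * (1 - r ^ (3 * i + 2)))"
  have "T sums (q - q * (qpoch (q ^ 3) q * qpoch (q ^ 3) (1 / q)) - q\<^sup>2 * qpoch_tail_sum (q ^ 3) q)"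
    unfolding T_def by (rule shifted_qpoch_tail_sums[OF q3 q(2)])
  also have "qpoch (q ^ 3) (1 / q) = (1 - 1 / q) * qpoch (q ^ 3) (q\<^sup>2)"
    using qpoch_rec[OF q3(1), of "1 / q"] q by (simp add: eval_nat_numeral)
  also have "q - q * (qpoch (q ^ 3) q * ((1 - 1 / q) * qpoch (q ^ 3) (q\<^sup>2))) - q\<^sup>2 * qpoch_tail_sum (q ^ 3) q
     = q + (1 - q) * Th - q\<^sup>2 * qpoch_tail_sum (q ^ 3) q"
    using q by (simp add: Th_def algebra_simps)
  finally have "(\<lambda>n. P * T n) sums (P * (q + (1 - q) * Th - q\<^sup>2 * qpoch_tail_sum (q ^ 3) q))"
    by (rule sums_mult)
  note PT_sums = this
  have PT: "P * T n = complex_of_real (r ^ (3 * n) / d n)" for n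
  proof -
    have dn: "complex_of_real (d n) = (\<Prod>k<n. 1 - q * (q ^ 3) ^ k) * (\<Prod>k<n. 1 - q\<^sup>2 * (q ^ 3) ^ k)"
    proof -
      have "complex_of_real (r ^ (3 * i + 1)) = q * (q ^ 3) ^ i"
        "complex_of_real (r ^ (3 * i + 2)) = q\<^sup>2 * (q ^ 3) ^ i" for i
        by (simp_all add: q_def power_add power_mult power2_eq_square)
      thus ?thesis
        unfolding d_def by (simp only: of_real_prod of_real_mult of_real_diff of_real_1 prod.distrib)
    qed
    have "(q ^ 3) ^ (n + 1) / q = q\<^sup>2 * (q ^ 3) ^ n"
      using q by (simp add: eval_nat_numeral)
    hence "complex_of_real (d n) * T n = (q ^ 3) ^ n * Th"
      unfolding dn T_def Th_def using qpoch_split[OF q3(1), of q n] qpoch_split[OF q3(1), of "q\<^sup>2" n]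
      by (simp add: mult_ac)
    moreover have "d n \<noteq> 0"
    proof -
      have "r ^ Suc k \<noteq> 1" for k
        using r power_less_one_iff[of r "Suc k"] by simp
      from this[of "3 * i" for i] this[of "3 * i + 1" for i] show ?thesis
        unfolding d_def by (auto simp: prod_zero_iff)
    qed
    ultimately have "P * T n = (q ^ 3) ^ n * (P * Th) / complex_of_real (d n)"
      by (simp add: field_simps)
    thus ?thesis
      using P by (simp add: Th_def q_def power_mult)
  qed
  \<comment> \<open>The term n = 0 corresponds to no partition counted by \<open>C3\<close> and is
    subtracted.\<close>
  have "P * T 0 = 1"
    unfolding PT by (simp add: d_def)
  with PT_sums have "(\<lambda>n. P * T (Suc n)) sums (P * (q + (1 - q) * Th - q\<^sup>2 * qpoch_tail_sum (q ^ 3) q) - 1)"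
    by (subst sums_Suc_iff) (simp del: of_real_divide)
  also have "P * (q + (1 - q) * Th - q\<^sup>2 * qpoch_tail_sum (q ^ 3) q) - 1 = P * (q - q\<^sup>2 * qpoch_tail_sum (q ^ 3) q) - q"
    using P unfolding Th_def by algebra
  finally have S: "(\<lambda>n. complex_of_real (r ^ (3 * Suc n) / d (Suc n))) sums (P * (q - q\<^sup>2 * qpoch_tail_sum (q ^ 3) q) - q)"
    unfolding PT .
  have "(\<lambda>n. real (C3 n) * r ^ n) sums Re (P * (q - q\<^sup>2 * qpoch_tail_sum (q ^ 3) q) - q)"
    using of_real_sumsD(1)[OF S] unfolding d_def by (intro C3_sums r)
  hence "(\<lambda>n. complex_of_real (real (C3 n) * r ^ n)) sums complex_of_real (Re (P * (q - q\<^sup>2 * qpoch_tail_sum (q ^ 3) q) - q))"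
    by (rule sums_of_real)
  thus ?thesis
    unfolding of_real_sumsD(2)[OF S] by (simp add: q_def)
qed

section \<open>Comparison of coefficients\<close>

text \<open>The half of Euler's pentagonal number series with exponents n(3n+1)/2.\<close>

definition pentagonal :: "complex \<Rightarrow> nat \<Rightarrow> complex" where
  "pentagonal q n = (-1) ^ n * q ^ (n * n + tri n)"

lemma le_tri: "n \<le> tri n"
  by (induction n) auto

lemma norm_lacunary_le:
  fixes q :: complex
  assumes q: "norm q < 1" and c: "\<And>n. norm (c n) \<le> B" and e: "\<And>n. n \<le> e n"
  shows "norm (c n * q ^ e n) \<le> B * norm q ^ n"
  unfolding norm_mult norm_power
  using q e[of n] c[of n] order.trans[OF norm_ge_zero c]
  by (intro mult_mono power_decreasing) auto

lemma summable_lacunary: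
  fixes q :: complex
  assumes "norm q < 1" "\<And>n. norm (c n) \<le> B" "\<And>n. n \<le> e n"
  shows "summable (\<lambda>n. c n * q ^ e n)"
proof (rule summable_comparison_test')
  show "summable (\<lambda>n. B * norm q ^ n)"
    using assms by (intro summable_mult summable_geometric) auto
qed (use norm_lacunary_le[of q c B e, OF assms] in auto)

text \<open>One coefficient sequence \<open>t\<close> must serve all \<open>q\<close> at once for
  coefficients to be compared later. It is obtained by reindexing along the injective map
  \<open>e\<close>.\<close>

lemma lacunary_power_series:
  fixes e :: "nat \<Rightarrow> nat" and c :: "nat \<Rightarrow> complex"
  assumes e: "strict_mono e" and c: "\<And>n. norm (c n) \<le> B"
  obtains t where "\<And>m. m \<notin> range e \<Longrightarrow> t m = 0"
    and "\<And>q :: complex. norm q < 1 \<Longrightarrow> (\<lambda>m. t m * q ^ m) sums (\<Sum>n. c n * q ^ e n)"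
proof
  define t where "t = (\<lambda>m. if m \<in> range e then c (the_inv e m) else 0)"
  have inj: "inj e" using e by (rule strict_mono_imp_inj_on)
  show "t m = 0" if "m \<notin> range e" for m
    using that by (auto simp: t_def)
  show "(\<lambda>m. t m * q ^ m) sums (\<Sum>n. c n * q ^ e n)" if q: "norm q < 1" for q :: complex
  proof -
    have "(\<lambda>n. c n * q ^ e n) sums (\<Sum>n. c n * q ^ e n)"
      using q c strict_mono_imp_increasing[OF e] by (intro summable_sums summable_lacunary)
    moreover have "t (e n) = c n" for n
      using inj by (simp add: t_def the_inv_f_f)
    ultimately show ?thesis
      using sums_mono_reindex[OF e, of "\<lambda>m. t m * q ^ m"] by (simp add: t_def image_iff)
  qed
qed

lemma pentagonal_sums:
  assumes q: "norm q < 1"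
  shows "pentagonal q sums (\<Sum>n. pentagonal q n)"
proof -
  have "summable (\<lambda>n. (-1) ^ n * q ^ (n * n + tri n))"
    using q by (intro summable_lacunary[where B = 1]) (auto intro: trans_le_add2 le_tri simp: norm_power)
  hence "summable (pentagonal q)"
    by (simp add: pentagonal_def[abs_def])
  thus ?thesis
    by (rule summable_sums)
qed

text \<open>Since 2k + 1 + 3 tri k = (k+1)(3k+4)/2 - 1, the k-th term of the partial theta series
  with base q^3 at x = q is - \<open>pentagonal q (k + 1)\<close> / q. Consecutive terms are then
  grouped in pairs.\<close>

lemma partial_theta_sums_pentagonal:
  fixes q :: complex
  assumes q: "norm q < 1" "q \<noteq> 0"
  shows "(\<lambda>n. partial_theta (q ^ 3) q n) sums ((1 - (\<Sum>n. pentagonal q n)) / q)"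
proof -
  have "pentagonal q 0 = 1"
    by (simp add: pentagonal_def)
  with pentagonal_sums[OF q(1)] have "(\<lambda>n. pentagonal q (Suc n)) sums ((\<Sum>n. pentagonal q n) - 1)"
    by (subst sums_Suc_iff) simp
  from sums_group[OF this, of 2]
  have "(\<lambda>n. pentagonal q (2 * n + 1) + pentagonal q (2 * n + 2)) sums ((\<Sum>n. pentagonal q n) - 1)"
    by (simp add: mult.commute atLeastLessThan_nat_numeral numeral_eq_Suc sum.atLeast_Suc_lessThan)
  moreover have "- 1 / q * (S - 1) = (1 - S) / q" for S
    using q by (simp add: field_simps)
  ultimately
  have "(\<lambda>n. - 1 / q * (pentagonal q (2 * n + 1) + pentagonal q (2 * n + 2))) sums ((1 - (\<Sum>n. pentagonal q n)) / q)"
    by (metis sums_mult)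
  moreover have "partial_theta (q ^ 3) q n = - 1 / q * (pentagonal q (2 * n + 1) + pentagonal q (2 * n + 2))" for n
  proof -
    have tri2: "tri (2 * n) = 2 * n * n + n"
      using two_tri[of "2 * n"] by simp
    have "2 * n + 2 = Suc (Suc (2 * n))" by simp
    hence tri_add: "tri (2 * n + 1) = tri (2 * n) + (2 * n + 1)" "tri (2 * n + 2) = tri (2 * n) + (4 * n + 3)"
      by simp_all
    have exps: "(2 * n + 1) * (2 * n + 1) + tri (2 * n + 1) = Suc (4 * n + 1 + 3 * tri (2 * n))"
      "(2 * n + 2) * (2 * n + 2) + tri (2 * n + 2) = Suc (4 * n + 3 + 3 * tri (2 * n + 1))"
      unfolding tri_add tri2 by (simp_all add: algebra_simps)
    have signs: "(-1 :: complex) ^ (2 * n + 1) = -1" "(-1 :: complex) ^ (2 * n + 2) = 1"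
      by simp_all
    have "pentagonal q (2 * n + 1) = - (q * (q ^ (4 * n + 1) * (q ^ 3) ^ tri (2 * n)))"
      "pentagonal q (2 * n + 2) = q * (q ^ (4 * n + 3) * (q ^ 3) ^ tri (2 * n + 1))"
      unfolding pentagonal_def exps signs by (simp_all only: power_Suc power_add power_mult) simp_all
    thus ?thesis
      using q by (simp add: partial_theta_def field_simps del: tri_Suc)
  qed
  ultimately show ?thesis
    by simp
qed

text \<open>The expansions at w and w^2 have the same sum and are combined with weights - w^2 and -
  w, which add up to 1. The theta products are (1 - w) P and (1 - w^2) P; under these weights the
  contributions of q^(2n+1) cancel and the constant ones add up to 3.\<close>

lemma qpoch_tail_sum_cube_root:
  fixes q w :: complex
  assumes w: "w\<^sup>2 + w + 1 = 0" and q: "norm q < 1" "q \<noteq> 0"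
  defines "P \<equiv> qpoch q (w * q) * qpoch q (w\<^sup>2 * q)"
  shows "(\<lambda>n. 3 * P * pentagonal q n - (w\<^sup>2 * partial_theta q w n + w * partial_theta q (w\<^sup>2) n)) sums qpoch_tail_sum q w"
proof -
  note w' = cube_root_props[OF w]
  have w4: "w\<^sup>2 * w\<^sup>2 = w" using w'(1) by algebra
  have w2: "w\<^sup>2 \<noteq> 0" using w'(2) by simp
  have inv: "1 / w\<^sup>2 = w" using w'(1) w2 by (simp add: divide_eq_eq power3_eq_cube power2_eq_square mult.assoc)
  have th: "theta q w = (1 - w) * P" "theta q (w\<^sup>2) = (1 - w\<^sup>2) * P"
  proof -
    have "q / w = w\<^sup>2 * q" "q / w\<^sup>2 = w * q"
      by (simp_all flip: w'(4))
    thus "theta q w = (1 - w) * P" "theta q (w\<^sup>2) = (1 - w\<^sup>2) * P"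
      using qpoch_rec[OF q(1), of w] qpoch_rec[OF q(1), of "w\<^sup>2"]
      by (simp_all add: theta_def P_def)
  qed
  have "(\<lambda>n. - (w\<^sup>2 * (partial_theta q w n + theta q w * theta_cofactor q w n)) - w * (partial_theta q (w\<^sup>2) n + theta q (w\<^sup>2) * theta_cofactor q (w\<^sup>2) n))
      sums (- (w\<^sup>2 * qpoch_tail_sum q w) - w * qpoch_tail_sum q (w\<^sup>2))"
    by (rule sums_diff[OF sums_minus[OF sums_mult[OF qpoch_tail_sum_expansion[OF q w'(2)]]]
          sums_mult[OF qpoch_tail_sum_expansion[OF q w2]]])
  also have "qpoch_tail_sum q (w\<^sup>2) = qpoch_tail_sum q w"
    using qpoch_tail_sum_inverse[OF q w'(2)] w'(4) by simp
  also have "- (w\<^sup>2 * qpoch_tail_sum q w) - w * qpoch_tail_sum q w = qpoch_tail_sum q w"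
    using w by algebra
  also have "(\<lambda>n. - (w\<^sup>2 * (partial_theta q w n + theta q w * theta_cofactor q w n)) - w * (partial_theta q (w\<^sup>2) n + theta q (w\<^sup>2) * theta_cofactor q (w\<^sup>2) n))
     = (\<lambda>n. 3 * P * pentagonal q n - (w\<^sup>2 * partial_theta q w n + w * partial_theta q (w\<^sup>2) n))"
  proof
    fix n
    have "w ^ (3 * n) = 1" "(w\<^sup>2) ^ (3 * n) = 1"
    proof -
      show "w ^ (3 * n) = 1" using w'(1) by (simp add: power_mult)
      have "(w\<^sup>2) ^ (3 * n) = (w ^ (3 * n))\<^sup>2" by (simp add: mult_ac flip: power_mult)
      thus "(w\<^sup>2) ^ (3 * n) = 1" using w'(1) by (simp add: power_mult)
    qed
    hence "theta_cofactor q w n = pentagonal q n * (1 - w\<^sup>2 * q ^ (2 * n + 1))"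
      "theta_cofactor q (w\<^sup>2) n = pentagonal q n * (1 - w * q ^ (2 * n + 1))"
      using w4 by (simp_all add: theta_cofactor_def pentagonal_def power2_eq_square[of "w\<^sup>2"])
    moreover have "- (w\<^sup>2 * (a + (1 - w) * P * (c * (1 - w\<^sup>2 * y)))) - w * (b + (1 - w\<^sup>2) * P * (c * (1 - w * y)))
        = 3 * P * c - (w\<^sup>2 * a + w * b)" for a b c y
      using w by algebra
    ultimately show "- (w\<^sup>2 * (partial_theta q w n + theta q w * theta_cofactor q w n)) - w * (partial_theta q (w\<^sup>2) n + theta q (w\<^sup>2) * theta_cofactor q (w\<^sup>2) n)
     = 3 * P * pentagonal q n - (w\<^sup>2 * partial_theta q w n + w * partial_theta q (w\<^sup>2) n)"
      unfolding th by simp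
  qed
  finally show ?thesis .
qed

text \<open>Convergence at all real points of (0, 1) extends to the unit disc, and a nonzero power
  series has no zeros in a small punctured disc, whereas this one vanishes on the interval.\<close>

lemma power_series_eq_0:
  fixes s :: "nat \<Rightarrow> complex"
  assumes s: "\<And>r :: real. 0 < r \<Longrightarrow> r < 1 \<Longrightarrow> (\<lambda>n. s n * of_real r ^ n) sums 0"
  shows "s m = 0"
proof (rule ccontr)
  assume "s m \<noteq> 0"
  \<comment> \<open>Multiplying the series by z makes f vanish at 0 and moves the nonzero
    coefficient to a positive index, as \<open>powser_0_nonzero\<close> requires even when m =
    0.\<close>
  define a where "a = (\<lambda>n. case n of 0 \<Rightarrow> 0 | Suc k \<Rightarrow> s k)"
  define f where "f = (\<lambda>z. z * (\<Sum>n. s n * z ^ n))"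
  have f: "(\<lambda>n. a n * (z - 0) ^ n) sums f z" if "norm (z - 0) < 1" for z
  proof -
    define r where "r = (1 + norm z) / 2"
    have r: "0 < r" "r < 1" "norm z < r"
      using that by (auto simp: r_def intro: add_pos_nonneg)
    have "summable (\<lambda>n. s n * z ^ n)"
      using r by (intro powser_inside[OF sums_summable[OF s]]) auto
    hence "(\<lambda>n. z * (s n * z ^ n)) sums f z"
      unfolding f_def by (intro sums_mult summable_sums)
    hence "(\<lambda>n. a (Suc n) * z ^ Suc n) sums f z"
      by (simp add: a_def mult_ac)
    from sums_Suc[OF this] show ?thesis
      by (simp add: a_def)
  qed
  have "f 0 = 0" "a (Suc m) \<noteq> 0" "Suc m > 0"
    using \<open>s m \<noteq> 0\<close> by (auto simp: f_def a_def)
  from powser_0_nonzero[OF zero_less_one f this(1) this(2,3)]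
  obtain \<delta> where \<delta>: "\<delta> > 0" "\<And>z. z \<in> cball 0 \<delta> - {0} \<Longrightarrow> f z \<noteq> 0"
    by blast
  define r where "r = min \<delta> (1 / 2)"
  have r: "0 < r" "r < 1" "r \<le> \<delta>" using \<delta> by (auto simp: r_def)
  have "f (of_real r) = 0"
    using sums_unique[OF s[OF r(1,2)]] by (simp add: f_def)
  moreover have "f (of_real r) \<noteq> 0"
    using r by (intro \<delta>(2)) auto
  ultimately show False by simp
qed

text \<open>Both generating functions, after tripling the first, contain 3 q P A, which cancels. In
  the series for \<open>C3\<close>, P times the theta product is 1, so the cofactor terms lose their
  infinite product and only sparse series remain.\<close>

lemma C3_minus_D3_sums:
  fixes r :: real and w :: complex
  assumes w: "w\<^sup>2 + w + 1 = 0" and r: "0 < r" "r < 1"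
  defines "q \<equiv> complex_of_real r"
  shows "(\<lambda>n. (3 * of_nat (C3 n) - of_nat (D3 n)) * q ^ n) sums
     (- 1 - 3 * q - 3 * (\<Sum>n. q\<^sup>2 * theta_cofactor (q ^ 3) q n) + (\<Sum>n. q * (w\<^sup>2 * partial_theta q w n + w * partial_theta q (w\<^sup>2) n)))"
proof -
  have q: "norm q < 1" "q \<noteq> 0" using r by (auto simp: q_def)
  have q3: "norm (q ^ 3) < 1" "q ^ 3 \<noteq> 0"
    using q by (simp_all add: norm_power power_less_one_iff)
  define P where "P = qpoch q (w * q) * qpoch q (w\<^sup>2 * q)"
  define Th where "Th = qpoch (q ^ 3) q * qpoch (q ^ 3) (q\<^sup>2)"
  define A where "A = (\<Sum>n. pentagonal q n)"
  define h where "h = qpoch_tail_sum q w"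
  define h3 where "h3 = qpoch_tail_sum (q ^ 3) q"
  define R where "R = (\<Sum>n. q * (w\<^sup>2 * partial_theta q w n + w * partial_theta q (w\<^sup>2) n))"
  define Z where "Z = (\<Sum>n. q\<^sup>2 * theta_cofactor (q ^ 3) q n)"
  have PTh: "P * Th = 1"
    unfolding P_def Th_def by (rule qpoch_cube_root_inverse[OF w q(1)])
  have A: "pentagonal q sums A"
    unfolding A_def by (rule pentagonal_sums[OF q(1)])
  have "(\<lambda>n. 3 * P * pentagonal q n - (3 * P * pentagonal q n - (w\<^sup>2 * partial_theta q w n + w * partial_theta q (w\<^sup>2) n))) sums (3 * P * A - h)"
    unfolding h_def P_def by (intro sums_diff qpoch_tail_sum_cube_root[OF w q] sums_mult A)
  hence "(\<lambda>n. w\<^sup>2 * partial_theta q w n + w * partial_theta q (w\<^sup>2) n) sums (3 * P * A - h)"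
    by simp
  hence R: "R = q * (3 * P * A - h)"
    unfolding R_def by (intro sums_unique[symmetric] sums_mult)
  have "theta (q ^ 3) q = Th"
    using q by (simp add: theta_def Th_def eval_nat_numeral)
  hence "(\<lambda>n. partial_theta (q ^ 3) q n + Th * theta_cofactor (q ^ 3) q n) sums h3"
    using qpoch_tail_sum_expansion[OF q3 q(2)] by (simp add: h3_def)
  hence "(\<lambda>n. P * ((partial_theta (q ^ 3) q n + Th * theta_cofactor (q ^ 3) q n) - partial_theta (q ^ 3) q n)) sums (P * (h3 - (1 - A) / q))"
    unfolding A_def by (intro sums_mult sums_diff partial_theta_sums_pentagonal q)
  also have "(\<lambda>n. P * ((partial_theta (q ^ 3) q n + Th * theta_cofactor (q ^ 3) q n) - partial_theta (q ^ 3) q n)) = theta_cofactor (q ^ 3) q"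
    using PTh by (simp flip: mult.assoc)
  finally have theta_cofactor_sums: "theta_cofactor (q ^ 3) q sums (P * (h3 - (1 - A) / q))" .
  hence "Z = q\<^sup>2 * (P * (h3 - (1 - A) / q))"
    unfolding Z_def by (intro sums_unique[symmetric] sums_mult)
  hence Z: "Z = P * (q\<^sup>2 * h3 - q * (1 - A))"
  proof -
    have "q * ((1 - A) / q) = 1 - A"
      using q by simp
    with \<open>Z = q\<^sup>2 * (P * (h3 - (1 - A) / q))\<close> show ?thesis
      by algebra
  qed
  have "(\<lambda>n. 3 * (of_nat (C3 n) * q ^ n) - of_nat (D3 n) * q ^ n) sums
     (3 * (P * (q - q\<^sup>2 * h3) - q) - (1 + q * h))"
    unfolding h_def h3_def q_def
    by (rule sums_diff[OF sums_mult[OF C3_sums_qpoch_tail_sum[OF r PTh[unfolded Th_def q_def]]] D3_sums_qpoch_tail_sum[OF w r]])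
  also have "3 * (P * (q - q\<^sup>2 * h3) - q) - (1 + q * h) = - 1 - 3 * q - 3 * Z + R"
    unfolding R Z by (simp add: algebra_simps)
  finally show ?thesis
    unfolding R_def Z_def by (simp add: algebra_simps)
qed

lemma lacunary_difference_power_series:
  fixes e e' :: "nat \<Rightarrow> nat" and c c' :: "nat \<Rightarrow> complex"
  assumes e: "strict_mono e" "strict_mono e'"
    and c: "\<And>n. norm (c n) \<le> B" "\<And>n. norm (c' n) \<le> B"
  obtains t where "\<And>m. m \<notin> range e \<Longrightarrow> m \<notin> range e' \<Longrightarrow> t m = 0"
    and "\<And>q :: complex. norm q < 1 \<Longrightarrow>
      (\<lambda>m. t m * q ^ m) sums (\<Sum>n. c n * q ^ e n - c' n * q ^ e' n)"
proof -
  obtain t where t: "\<And>m. m \<notin> range e \<Longrightarrow> t m = 0"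
    "\<And>q :: complex. norm q < 1 \<Longrightarrow> (\<lambda>m. t m * q ^ m) sums (\<Sum>n. c n * q ^ e n)"
    by (rule lacunary_power_series[OF e(1) c(1)]) (rule that)
  obtain t' where t': "\<And>m. m \<notin> range e' \<Longrightarrow> t' m = 0"
    "\<And>q :: complex. norm q < 1 \<Longrightarrow> (\<lambda>m. t' m * q ^ m) sums (\<Sum>n. c' n * q ^ e' n)"
    by (rule lacunary_power_series[OF e(2) c(2)]) (rule that)
  show ?thesis
  proof
    show "t m - t' m = 0" if "m \<notin> range e" "m \<notin> range e'" for m
      using t(1) t'(1) that by simp
    show "(\<lambda>m. (t m - t' m) * q ^ m) sums (\<Sum>n. c n * q ^ e n - c' n * q ^ e' n)"
      if q: "norm q < 1" for q :: complex
    proof -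
      have "summable (\<lambda>n. c n * q ^ e n)" "summable (\<lambda>n. c' n * q ^ e' n)"
        using q c e by (auto intro!: summable_lacunary strict_mono_imp_increasing)
      thus ?thesis
        using sums_diff[OF t(2)[OF q] t'(2)[OF q]] by (simp add: suminf_diff left_diff_distrib)
    qed
  qed
qed

lemma strict_mono_tri_add_1:
  assumes "strict_mono k"
  shows "strict_mono (\<lambda>n. tri (k n) + 1)"
proof -
  have "strict_mono tri"
    by (simp add: strict_mono_Suc_iff)
  thus ?thesis
    using assms by (simp add: strict_mono_def)
qed

text \<open>Twice the first exponent 2 + 3n + 3n(3n+1)/2 is (3n+1)(3n+2) + 2; adding 6n + 5 leads to
  the second.\<close>

lemma theta_cofactor_eq_triangular:
  "q\<^sup>2 * theta_cofactor (q ^ 3) q n = (-1) ^ n * q ^ (tri (3 * n + 1) + 1) - (-1) ^ n * q ^ (tri (3 * n + 3) + 1)"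
proof -
  have tri3: "2 * tri (3 * n) = 9 * n * n + 3 * n"
    using two_tri[of "3 * n"] by simp
  have "3 * n + 3 = Suc (Suc (Suc (3 * n)))" by simp
  hence "tri (3 * n + 3) = tri (Suc (Suc (Suc (3 * n))))"
    by (rule arg_cong)
  also have "\<dots> = tri (3 * n) + (9 * n + 6)"
    by simp
  finally have tri33: "tri (3 * n + 3) = tri (3 * n) + (9 * n + 6)" .
  have "tri (3 * n + 1) + 1 = 2 + (3 * n + 3 * (n * n + tri n))"
    "tri (3 * n + 3) + 1 = 2 + (3 * n + 3 * (n * n + tri n)) + (2 + 3 * (2 * n + 1))"
    unfolding tri33 using tri3 two_tri[of n] by (simp_all add: algebra_simps)
  hence exps: "q ^ (tri (3 * n + 1) + 1) = q\<^sup>2 * (q ^ (3 * n) * (q ^ 3) ^ (n * n + tri n))"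
    "q ^ (tri (3 * n + 3) + 1) = q\<^sup>2 * (q ^ (3 * n) * (q ^ 3) ^ (n * n + tri n)) * (q\<^sup>2 * (q ^ 3) ^ (2 * n + 1))"
    by (simp_all only: power_add power_mult)
  show ?thesis
    unfolding exps by (simp only: theta_cofactor_def right_diff_distrib mult_ac mult_1_left mult_1_right)
qed

theorem theorem1p6:
  fixes n :: nat
  assumes "n > 0"
    and "\<not> (\<exists>k::nat. n = k * (k + 1) div 2 + 1)"
  shows "real (C3 n) = 1 / 3 * real (D3 n)"
proof -
  define w where "w = Complex (- 1 / 2) (sqrt 3 / 2)"
  have w: "w\<^sup>2 + w + 1 = 0"
    by (simp add: w_def complex_eq_iff power2_eq_square)
  note norm_w = cube_root_props(3)[OF w]
  \<comment> \<open>The coefficient that x^k receives when its values at w and w^2 are combined with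
    weights w^2 and w.\<close>
  define c where "c = (\<lambda>k. w\<^sup>2 * w ^ k + w * (w\<^sup>2) ^ k)"
  have norm_c: "norm (c k) \<le> 2" for k
  proof -
    have "norm (c k) \<le> norm (w\<^sup>2 * w ^ k) + norm (w * (w\<^sup>2) ^ k)"
      unfolding c_def by (rule norm_triangle_ineq)
    thus ?thesis
      by (simp add: norm_mult norm_power norm_w)
  qed
  have mono: "strict_mono (\<lambda>n. tri (a * n + b) + 1)" if "a > 0" for a b
    using that by (intro strict_mono_tri_add_1) (auto simp: strict_mono_def)
  obtain t where t: "\<And>m. m \<notin> range (\<lambda>n. tri (3 * n + 1) + 1) \<Longrightarrow> m \<notin> range (\<lambda>n. tri (3 * n + 3) + 1) \<Longrightarrow> t m = 0"
    "\<And>q :: complex. norm q < 1 \<Longrightarrow> (\<lambda>m. t m * q ^ m) sums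
      (\<Sum>n. (-1) ^ n * q ^ (tri (3 * n + 1) + 1) - (-1) ^ n * q ^ (tri (3 * n + 3) + 1))"
    using lacunary_difference_power_series[OF mono[of 3 1] mono[of 3 3],
        where c = "\<lambda>n. (-1) ^ n" and c' = "\<lambda>n. (-1) ^ n" and B = 1]
    by (simp only: norm_power norm_minus_cancel norm_one power_one order.refl zero_less_numeral) blast
  \<comment> \<open>The summand 0 keeps the exponent in the shape required by
    \<open>mono\<close>.\<close>
  obtain u where u: "\<And>m. m \<notin> range (\<lambda>n. tri (2 * n + 0) + 1) \<Longrightarrow> m \<notin> range (\<lambda>n. tri (2 * n + 1) + 1) \<Longrightarrow> u m = 0"
    "\<And>q :: complex. norm q < 1 \<Longrightarrow> (\<lambda>m. u m * q ^ m) sums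
      (\<Sum>n. c (4 * n + 1) * q ^ (tri (2 * n + 0) + 1) - c (4 * n + 3) * q ^ (tri (2 * n + 1) + 1))"
    using lacunary_difference_power_series[OF mono[of 2 0] mono[of 2 1], where c = "\<lambda>n. c (4 * n + 1)" and c' = "\<lambda>n. c (4 * n + 3)"
      and B = 2, OF zero_less_numeral zero_less_numeral norm_c norm_c] by blast
  \<comment> \<open>The coefficients of the explicit right-hand side of
    \<open>C3_minus_D3_sums\<close>, including - 1 and - 3 q.\<close>
  define v :: "nat \<Rightarrow> complex" where "v = (\<lambda>m. (if m = 0 then - 1 else 0) + (if m = 1 then - 3 else 0) - 3 * t m + u m)"
  have v: "(\<lambda>m. v m * q ^ m) sums
     (- 1 - 3 * q - 3 * (\<Sum>n. q\<^sup>2 * theta_cofactor (q ^ 3) q n) + (\<Sum>n. q * (w\<^sup>2 * partial_theta q w n + w * partial_theta q (w\<^sup>2) n)))"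
    if q: "norm q < 1" for q :: complex
  proof -
    have "c (4 * n + 1) * q ^ (tri (2 * n + 0) + 1) - c (4 * n + 3) * q ^ (tri (2 * n + 1) + 1) =
       q * (w\<^sup>2 * partial_theta q w n + w * partial_theta q (w\<^sup>2) n)" for n
      unfolding c_def partial_theta_def by (simp add: algebra_simps del: tri_Suc)
    hence "(\<lambda>m. u m * q ^ m) sums (\<Sum>n. q * (w\<^sup>2 * partial_theta q w n + w * partial_theta q (w\<^sup>2) n))"
      using u(2)[OF q] by simp
    moreover have "(\<lambda>m. t m * q ^ m) sums (\<Sum>n. q\<^sup>2 * theta_cofactor (q ^ 3) q n)"
      using t(2)[OF q] by (simp only: theta_cofactor_eq_triangular)
    moreover have "(\<lambda>m. if m = 0 then - 1 else 0) sums (- 1 :: complex)"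
      "(\<lambda>m. if m = 1 then - 3 * q else 0) sums (- 3 * q)"
      by (rule sums_single)+
    ultimately have "(\<lambda>m. (if m = 0 then - 1 else 0) + (if m = 1 then - 3 * q else 0) - 3 * (t m * q ^ m) + u m * q ^ m) sums
      (- 1 + - 3 * q - 3 * (\<Sum>n. q\<^sup>2 * theta_cofactor (q ^ 3) q n) + (\<Sum>n. q * (w\<^sup>2 * partial_theta q w n + w * partial_theta q (w\<^sup>2) n)))"
      by (intro sums_add sums_diff sums_mult)
    also have "(\<lambda>m. (if m = 0 then - 1 else 0) + (if m = 1 then - 3 * q else 0) - 3 * (t m * q ^ m) + u m * q ^ m) = (\<lambda>m. v m * q ^ m)"
      by (auto simp: v_def algebra_simps fun_eq_iff)
    finally show ?thesis
      by simp
  qed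
  have "3 * of_nat (C3 n) - of_nat (D3 n) - v n = 0"
  proof (rule power_series_eq_0[where s = "\<lambda>n. 3 * of_nat (C3 n) - of_nat (D3 n) - v n"])
    fix r :: real assume r: "0 < r" "r < 1"
    show "(\<lambda>n. (3 * of_nat (C3 n) - of_nat (D3 n) - v n) * complex_of_real r ^ n) sums 0"
      using sums_diff[OF C3_minus_D3_sums[OF w r] v[of "complex_of_real r"]] r
      by (simp add: left_diff_distrib)
  qed
  moreover have n: "n \<noteq> tri k + 1" for k
    using assms(2) by (auto simp: tri_def)
  have "t n = 0" "u n = 0"
    by (rule t(1) u(1); use n in blast)+
  \<comment> \<open>Positivity of n excludes the constant term, and k = 0 excludes n = 1, where - 3
    q contributes.\<close>
  hence "v n = 0"
    using assms(1) n[of 0] by (simp add: v_def)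
  ultimately have "complex_of_nat (3 * C3 n) = of_nat (D3 n)"
    by simp
  hence "3 * C3 n = D3 n"
    using of_nat_eq_iff by blast
  thus ?thesis
    by simp
qed

end
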